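(* For every finite set $A=\{a_1<a_2<\cdots<a_k\}$ of positive integers there exists a bijection $\psi:\mathcal{BP}(A)\to c\mathcal{BP}(A)$ that preserves the box-neighbor-set, i.e. the box-neighbor-set of $\psi(w)$ equals the box-neighbor-set of $w$ for every $w\in\mathcal{BP}(A)$.
   Context: Let $\Box$ be an extra symbol. A box-permutation on $A$ is a word $w$ over $A\cup\{\Box\}$ in which each element of $A$ appears exactly once, such that: if $\Box$ does not occur then $w=a_1a_2\cdots a_k$; otherwise the (box-free) segment before the first box and the segment after the last box each have length at least one and are increasing, and every segment between two successive boxes has length at least two and is increasing. $\mathcal{BP}(A)$ is the set of box-permutations on $A$ (e.g. $\mathcal{BP}([3])=\{123,1\Box23,2\Box13,3\Box12,12\Box3,13\Box2,23\Box1\}$). A cycle $C=(c_1\cdots c_{2\ell+1})$ of odd length, considered up to cyclic rotation, with entries in $A\cup\{\Box\}$ and each element of $A$ at most once, is an odd box-cycle (resp. reverse odd box-cycle) on $A$ if either $C=(a)$ for a single $a\in A$, or $\ell\ge1$, $C$ contains at least one box, no two boxes are cyclically adjacent, and every maximal cyclically consecutive run of integers in $C$ has length at least two and is increasing in the clockwise (i.e. left-to-right cyclic) direction (resp. in the counterclockwise direction). A cyclic box-permutation on $A$ is a set of cycles, each an odd box-cycle or a reverse odd box-cycle on $A$, such that every element of $A$ appears in exactly one of them; $c\mathcal{BP}(A)$ is the set of these (e.g. $c\mathcal{BP}([3])=\{(1)(2)(3),(1)(23\Box),(1)(32\Box),(2)(13\Box),(2)(31\Box),(3)(12\Box),(3)(21\Box)\}$).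 The box-neighbor-set of a box-permutation (resp. cyclic box-permutation) is the set of all 2-subsets $\{a,b\}$ such that $a,b$ are the two neighbors (resp. two cyclic neighbors) of some box. *)

theory Defs
  imports Main
begin

datatype sym = Box | Num nat

fun segs :: "sym list \<Rightarrow> nat list list" where
  "segs [] = [[]]"
| "segs (Box # w) = [] # segs w"
| "segs (Num a # w) = (a # hd (segs w)) # tl (segs w)"

definition BP :: "nat set \<Rightarrow> sym list set" where
  "BP A = {w. set w \<subseteq> insert Box (Num ` A)
              \<and> (\<forall>a\<in>A. count_list w (Num a) = 1)
              \<and> (Box \<notin> set w \<longrightarrow> w = map Num (sorted_list_of_set A))
              \<and> (Box \<in> set w \<longrightarrow>
                   (let ss = segs w in
                      length (hd ss) \<ge> 1 \<and> length (last ss) \<ge> 1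
                    \<and> (\<forall>i. 0 < i \<and> i + 1 < length ss \<longrightarrow> length (ss ! i) \<ge> 2)
                    \<and> (\<forall>s\<in>set ss. sorted_wrt (<) s)))}"

text \<open>Cycle given by a representative list (clockwise = left-to-right cyclic order).
  Condition on runs: rotating any box to the front, the maximal runs of integers
  are exactly the segments of the remaining word.\<close>
definition box_cycle_gen :: "(nat \<Rightarrow> nat \<Rightarrow> bool) \<Rightarrow> nat set \<Rightarrow> sym list \<Rightarrow> bool" where
  "box_cycle_gen R A c \<longleftrightarrow>
     (\<exists>a\<in>A. c = [Num a])
   \<or> (odd (length c) \<and> length c \<ge> 3
      \<and> set c \<subseteq> insert Box (Num ` A)
      \<and> (\<forall>a\<in>A. count_list c (Num a) \<le> 1)
      \<and> Box \<in> set c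
      \<and> (\<forall>i<length c. \<not> (c ! i = Box \<and> c ! ((i + 1) mod length c) = Box))
      \<and> (\<forall>n rest. rotate n c = Box # rest \<longrightarrow>
            (\<forall>s\<in>set (segs rest). length s \<ge> 2 \<and> sorted_wrt R s)))"

definition odd_box_cycle :: "nat set \<Rightarrow> sym list \<Rightarrow> bool" where
  "odd_box_cycle A c \<longleftrightarrow> box_cycle_gen (<) A c"

definition rev_odd_box_cycle :: "nat set \<Rightarrow> sym list \<Rightarrow> bool" where
  "rev_odd_box_cycle A c \<longleftrightarrow> box_cycle_gen (>) A c"

definition cyc :: "sym list \<Rightarrow> sym list set" where
  "cyc c = range (\<lambda>n. rotate n c)"

definition cBP :: "nat set \<Rightarrow> sym list set set set" where
  "cBP A = {S. (\<forall>X\<in>S. \<exists>c. X = cyc c \<and> (odd_box_cycle A c \<or> rev_odd_box_cycle A c))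
              \<and> (\<forall>a\<in>A. \<exists>!X. X \<in> S \<and> Num a \<in> \<Union> (set ` X))}"

definition box_nbrs :: "sym list \<Rightarrow> nat set set" where
  "box_nbrs w = {{a, b} | a b i. 0 < i \<and> i + 1 < length w \<and> w ! i = Box
                   \<and> w ! (i - 1) = Num a \<and> w ! (i + 1) = Num b}"

definition cyc_box_nbrs :: "sym list \<Rightarrow> nat set set" where
  "cyc_box_nbrs c = {{a, b} | a b i. i < length c \<and> c ! i = Box
                   \<and> c ! ((i + length c - 1) mod length c) = Num a
                   \<and> c ! ((i + 1) mod length c) = Num b}"

definition cbox_nbrs :: "sym list set set \<Rightarrow> nat set set" where
  "cbox_nbrs S = (\<Union>X\<in>S. \<Union>c\<in>X. cyc_box_nbrs c)"

end

theory Submission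
  imports Defs
begin

text \<open>
  Every number of a box-permutation neighbours at most one box, so a box-permutation is a sequence
  of tokens, each a free number \<open>u\<close> or a block \<open>a \<box> b\<close>, in which the last number of a token
  is smaller than the first number of the next one. Reversing a sequence of tokens flips its blocks
  and turns ascents between tokens into descents, so an odd cycle through the maximum \<open>k\<close> of \<open>A\<close>,
  in either direction, is an ascending sequence \<open>cs\<close> of odd length whose first number is \<open>k\<close>.

  Split a box-permutation as \<open>us @ cs\<close>, where \<open>cs\<close> begins at the token with first number \<open>k\<close>.
  If \<open>cs\<close> has odd length, it closes up to an odd cycle. Otherwise apply a sign-reversing
  involution: of the last tokens of \<open>us\<close> and \<open>cs\<close>, flip the one with the larger last number and
  move it to the end of the other sequence. Then \<open>cs\<close> has odd length, and it is closed up to a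
  reverse odd cycle. Recursion on the numbers outside the cycle gives the bijection.
\<close>

section \<open>Tokens and their words\<close>

datatype token = Free nat | Boxed nat nat

primrec fst_num :: "token \<Rightarrow> nat" where
  "fst_num (Free a) = a"
| "fst_num (Boxed a b) = a"

primrec lst_num :: "token \<Rightarrow> nat" where
  "lst_num (Free a) = a"
| "lst_num (Boxed a b) = b"

primrec flip :: "token \<Rightarrow> token" where
  "flip (Free a) = Free a"
| "flip (Boxed a b) = Boxed b a"

primrec token_nums :: "token \<Rightarrow> nat list" where
  "token_nums (Free a) = [a]"
| "token_nums (Boxed a b) = [a, b]"

primrec token_word :: "token \<Rightarrow> sym list" where
  "token_word (Free a) = [Num a]"
| "token_word (Boxed a b) = [Num a, Box, Num b]"

definition nums :: "token list \<Rightarrow> nat list" where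
  "nums ts = concat (map token_nums ts)"

definition word :: "token list \<Rightarrow> sym list" where
  "word ts = concat (map token_word ts)"

text \<open>Only consecutive tokens are compared: a block \<open>Boxed a b\<close> may have
  \<open>a > b\<close>, so the relation is not transitive and \<open>sorted_wrt\<close> would be too
  strong.\<close>

abbreviation chain :: "token list \<Rightarrow> bool" where
  "chain \<equiv> successively (\<lambda>x y. lst_num x < fst_num y)"

definition paths :: "nat set \<Rightarrow> token list set" where
  "paths A = {ts. chain ts \<and> distinct (nums ts) \<and> set (nums ts) = A}"

definition nbrs :: "token list \<Rightarrow> nat set set" where
  "nbrs ts = {{a, b} | a b. Boxed a b \<in> set ts}"

lemma fst_num_flip [simp]: "fst_num (flip t) = lst_num t"
  and lst_num_flip [simp]: "lst_num (flip t) = fst_num t"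
  and flip_flip [simp]: "flip (flip t) = t"
  and token_nums_flip [simp]: "set (token_nums (flip t)) = set (token_nums t)"
    "distinct (token_nums (flip t)) = distinct (token_nums t)"
  by (cases t; auto)+

lemma num_in_token_nums [simp]:
  "fst_num t \<in> set (token_nums t)" "lst_num t \<in> set (token_nums t)"
  by (cases t; simp)+

lemma token_nums_eq: "set (token_nums t) = {fst_num t, lst_num t}"
  by (cases t) auto

lemma nums_simps [simp]:
  "nums [] = []" "nums (t # ts) = token_nums t @ nums ts" "nums (ts @ us) = nums ts @ nums us"
  by (simp_all add: nums_def)

lemma word_simps [simp]:
  "word [] = []" "word (t # ts) = token_word t @ word ts" "word (ts @ us) = word ts @ word us"
  by (simp_all add: word_def)

lemma set_nums: "set (nums ts) = (\<Union>t\<in>set ts. set (token_nums t))"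
  by (simp add: nums_def)

lemma nbrs_append [simp]: "nbrs (ts @ us) = nbrs ts \<union> nbrs us"
  and nbrs_Nil [simp]: "nbrs [] = {}"
  by (auto simp: nbrs_def)

lemma nbrs_flip [simp]: "nbrs [flip t] = nbrs [t]"
  by (cases t) (auto simp: nbrs_def)

lemma word_eq_Nil [simp]: "word ts = [] \<longleftrightarrow> ts = []"
proof (cases ts)
  case (Cons t us)
  then show ?thesis by (cases t) auto
qed simp

lemma hd_word: "ts \<noteq> [] \<Longrightarrow> hd (word ts) = Num (fst_num (hd ts))"
proof (cases ts)
  case (Cons t us)
  then show ?thesis by (cases t) auto
qed simp

lemma last_word: "ts \<noteq> [] \<Longrightarrow> last (word ts) = Num (lst_num (last ts))"
proof (cases ts rule: rev_cases)
  case (snoc us t)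
  then show ?thesis by (cases t) auto
qed simp

text \<open>No word begins with a box, so the symbol after the leading number decides whether the
  first token is free or a block.\<close>

lemma word_inj: "word ts = word us \<Longrightarrow> ts = us"
proof (induction ts arbitrary: us)
  case Nil
  then show ?case by (metis word_eq_Nil word_simps(1))
next
  case (Cons t ts)
  then obtain u us' where us: "us = u # us'"
    by (metis list.exhaust list.distinct(1) word_eq_Nil)
  have nb: "word vs \<noteq> Box # w" for vs w
    using hd_word[of vs] by (cases "vs = []") auto
  have "t = u \<and> word ts = word us'"
    using Cons.prems nb by (cases t; cases u) (auto simp: us dest: sym)
  with Cons.IH us show ?case by auto
qed

lemma count_word: "count_list (word ts) (Num a) = count_list (nums ts) a"
proof (induction ts)
  case (Cons t ts)
  then show ?case by (cases t) auto
qed simp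

lemma Num_in_word [simp]: "Num a \<in> set (word ts) \<longleftrightarrow> a \<in> set (nums ts)"
  by (metis count_word count_list_0_iff)

lemma set_word: "set (word ts) \<subseteq> insert Box (Num ` set (nums ts))"
proof
  show "x \<in> insert Box (Num ` set (nums ts))" if "x \<in> set (word ts)" for x
    using that by (induction x) simp_all
qed

text \<open>Each token contributes one or three symbols. Hence the parity that \<open>move\<close>
  controls on tokens is the parity of the cycle length.\<close>

lemma odd_length_word: "odd (length (word ts)) \<longleftrightarrow> odd (length ts)"
proof (induction ts)
  case (Cons t ts)
  then show ?case by (cases t) auto
qed simp

lemma distinct_if_count_list_1: "(\<And>x. x \<in> set xs \<Longrightarrow> count_list xs x = 1) \<Longrightarrow> distinct xs"
proof (induction xs)
  case (Cons x xs)
  have "x \<notin> set xs"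
    using Cons.prems[of x] by (simp add: count_list_0_iff)
  moreover have "count_list xs y = 1" if "y \<in> set xs" for y
    using Cons.prems[of y] that calculation by (auto split: if_splits)
  ultimately show ?case using Cons.IH by simp
qed simp

lemma count_list_distinct: "distinct xs \<Longrightarrow> x \<in> set xs \<Longrightarrow> count_list xs x = 1"
  by (induction xs) auto

section \<open>The involution and the split at the maximum\<close>

fun move :: "token list \<times> token list \<Rightarrow> token list \<times> token list" where
  "move (us, cs) =
     (if cs \<noteq> [] \<and> (us = [] \<or> lst_num (last us) < lst_num (last cs))
      then (us @ [flip (last cs)], butlast cs)
      else (butlast us, cs @ [flip (last us)]))"

text \<open>When no token has first number \<open>k\<close>, the number \<open>k\<close> ends the last token of \<open>us\<close>, which is
  then a block; \<open>move\<close> turns it into the first token of \<open>cs\<close>.\<close>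

definition splits :: "nat set \<Rightarrow> nat \<Rightarrow> (token list \<times> token list) set" where
  "splits A k = {(us, cs). chain us \<and> chain cs \<and> distinct (nums us @ nums cs)
     \<and> set (nums us) \<union> set (nums cs) = A
     \<and> (cs \<noteq> [] \<longrightarrow> fst_num (hd cs) = k)
     \<and> (cs = [] \<longrightarrow> us \<noteq> [] \<and> (\<exists>b. last us = Boxed b k))}"

text \<open>The comparison in \<open>move\<close> is exactly the chain condition at the new
  junction, since a flipped token starts with its old last number. It now ends with its old first
  number, which exceeds the last number of the sequence it left, so a second \<open>move\<close>
  picks it again. The split \<open>[Free k]\<close> is excluded because moving \<open>Free k\<close>
  away would not leave \<open>us\<close> ending in a block.\<close>

lemma move_splits:
  assumes S: "(us, cs) \<in> splits A k" and "cs \<noteq> [Free k]" and "\<forall>a\<in>A. a \<le> k"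
    and mv: "move (us, cs) = (us', cs')"
  shows "(us', cs') \<in> splits A k" "move (us', cs') = (us, cs)"
    "odd (length cs') \<longleftrightarrow> even (length cs)" "cs' \<noteq> [Free k]"
    "nbrs us' \<union> nbrs cs' = nbrs us \<union> nbrs cs"
proof -
  have *: "(us', cs') \<in> splits A k \<and> move (us', cs') = (us, cs)
    \<and> (odd (length cs') \<longleftrightarrow> even (length cs)) \<and> cs' \<noteq> [Free k]
    \<and> nbrs us' \<union> nbrs cs' = nbrs us \<union> nbrs cs"
  proof (cases "cs \<noteq> [] \<and> (us = [] \<or> lst_num (last us) < lst_num (last cs))")
    case True
    then obtain ds y where cs: "cs = ds @ [y]" by (metis rev_exhaust)
    have lt: "us = [] \<or> lst_num (last us) < lst_num y" using True cs by auto
    have eq: "us' = us @ [flip y]" "cs' = ds" using mv True cs by auto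
    have ch: "chain us" "chain ds" "ds = [] \<or> lst_num (last ds) < fst_num y"
      using S unfolding cs by (auto simp: splits_def successively_append_iff)
    \<comment> \<open>If \<open>cs\<close> is emptied, the token moved out is a block starting with
      \<open>k\<close>; flipped, it is the final block that \<open>splits\<close> requires.\<close>
    have ne: "\<exists>b. y = Boxed k b" if "ds = []"
      using S assms(2) that unfolding cs by (cases y) (auto simp: splits_def)
    have "fst_num y \<in> A" using S unfolding cs by (cases y) (auto simp: splits_def)
    then have "ds \<noteq> [Free k]" using ch assms(3) by auto
    moreover have "(us @ [flip y], ds) \<in> splits A k"
      using S ch lt ne unfolding cs
      by (cases "ds = []") (auto simp: splits_def successively_append_iff)
    moreover have "move (us @ [flip y], ds) = (us, ds @ [y])" using ch by auto
    moreover have "nbrs (us @ [flip y]) \<union> nbrs ds = nbrs us \<union> nbrs (ds @ [y])"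
      by auto
    ultimately show ?thesis unfolding eq cs by auto
  next
    case False
    \<comment> \<open>An empty \<open>cs\<close> forces a final block in \<open>us\<close>, so
      \<open>move\<close> never evaluates \<open>last []\<close>.\<close>
    have "us \<noteq> []" using S False by (cases "cs = []") (auto simp: splits_def)
    then obtain vs x where us: "us = vs @ [x]" by (metis rev_exhaust)
    have eq: "us' = vs" "cs' = cs @ [flip x]" using mv False us by auto
    have ch: "chain vs" "chain cs" "vs = [] \<or> lst_num (last vs) < fst_num x"
      using S unfolding us by (auto simp: splits_def successively_append_iff)
    \<comment> \<open>The failed comparison gives only a weak inequality; disjointness of the
      numbers makes it strict.\<close>
    have lt: "lst_num (last cs) < lst_num x" if ne: "cs \<noteq> []"
    proof -
      have "lst_num (last cs) \<in> set (nums cs)"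
        using ne by (auto simp: set_nums intro!: bexI[of _ "last cs"])
      moreover have "lst_num x \<notin> set (nums cs)"
      proof -
        have "lst_num x \<in> set (nums us)" by (simp add: us)
        moreover have "set (nums us) \<inter> set (nums cs) = {}" using S by (simp add: splits_def)
        ultimately show ?thesis by blast
      qed
      ultimately show ?thesis using False ne us by (auto simp: not_less) (metis le_neq_implies_less)
    qed
    have emp: "\<exists>b. x = Boxed b k" if "cs = []"
      using S that unfolding us by (auto simp: splits_def)
    have "cs @ [flip x] \<noteq> [Free k]" using emp by auto
    moreover have "(vs, cs @ [flip x]) \<in> splits A k"
      using S ch lt emp unfolding us
      by (cases "cs = []") (auto simp: splits_def successively_append_iff)
    moreover have "move (vs, cs @ [flip x]) = (vs @ [x], cs)" using ch by auto
    moreover have "nbrs vs \<union> nbrs (cs @ [flip x]) = nbrs (vs @ [x]) \<union> nbrs cs"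
      by auto
    ultimately show ?thesis unfolding eq us by auto
  qed
  then show "(us', cs') \<in> splits A k" "move (us', cs') = (us, cs)"
    "odd (length cs') \<longleftrightarrow> even (length cs)" "cs' \<noteq> [Free k]"
    "nbrs us' \<union> nbrs cs' = nbrs us \<union> nbrs cs" by blast+
qed

text \<open>The number \<open>k\<close> is the maximum and occurs once. If \<open>cs\<close> is
  nonempty, it starts with \<open>k\<close>, so the junction is an ascent and no token of
  \<open>us\<close> starts with \<open>k\<close>. If \<open>cs\<close> is empty, \<open>k\<close> is
  already spent as the second number of the last block.\<close>

lemma splits_append:
  assumes "(us, cs) \<in> splits A k" "\<forall>a\<in>A. a \<le> k"
  shows "us @ cs \<in> paths A" "takeWhile (\<lambda>t. fst_num t \<noteq> k) (us @ cs) = us"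
    "dropWhile (\<lambda>t. fst_num t \<noteq> k) (us @ cs) = cs"
proof -
  have S: "chain us" "chain cs" "distinct (nums us @ nums cs)" "set (nums us) \<union> set (nums cs) = A"
    "cs \<noteq> [] \<longrightarrow> fst_num (hd cs) = k" "cs = [] \<longrightarrow> us \<noteq> [] \<and> (\<exists>b. last us = Boxed b k)"
    using assms(1) by (auto simp: splits_def)
  have k: "k \<in> set (nums cs)" if "cs \<noteq> []"
    using that S(5) by (cases cs) auto
  have kl: "lst_num (last us) < k" if "us \<noteq> []" "cs \<noteq> []"
  proof -
    have "lst_num (last us) \<in> set (nums us)"
      using that by (auto simp: set_nums intro!: bexI[of _ "last us"])
    moreover from this have "lst_num (last us) \<le> k" using S(4) assms(2) by blast
    moreover have "set (nums us) \<inter> set (nums cs) = {}" using S(3) by simp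
    ultimately show ?thesis using k[OF that(2)] by (metis IntI empty_iff le_neq_implies_less)
  qed
  show "us @ cs \<in> paths A"
    using S kl by (auto simp: paths_def successively_append_iff)
  have ne: "fst_num t \<noteq> k" if "t \<in> set us" for t
  proof (cases "cs = []")
    case True
    then obtain vs b where us: "us = vs @ [Boxed b k]" using S(6) by (metis append_butlast_last_id)
    from that consider "t \<in> set vs" | "t = Boxed b k" by (auto simp: us)
    then show ?thesis
    proof cases
      case 1
      then have "fst_num t \<in> set (nums vs)" by (auto simp: set_nums intro!: bexI[of _ t])
      then show ?thesis using S(3) by (auto simp: us)
    qed (use S(3) us in auto)
  next
    case False
    have "fst_num t \<in> set (nums us)" using that by (auto simp: set_nums intro!: bexI[of _ t])
    then show ?thesis using S(3) k[OF False] by auto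
  qed
  show "takeWhile (\<lambda>t. fst_num t \<noteq> k) (us @ cs) = us"
    using ne S(5) by (cases cs) simp_all
  show "dropWhile (\<lambda>t. fst_num t \<noteq> k) (us @ cs) = cs"
    using ne S(5) by (cases cs) simp_all
qed

text \<open>If no token starts with \<open>k\<close>, then \<open>k\<close> is the second number of
  a block. A further token would have to start with a number above the maximum, so this block is the
  last token.\<close>

lemma split_path:
  assumes "ts \<in> paths A" "k \<in> A" "\<forall>a\<in>A. a \<le> k"
  shows "(takeWhile (\<lambda>t. fst_num t \<noteq> k) ts, dropWhile (\<lambda>t. fst_num t \<noteq> k) ts) \<in> splits A k"
proof -
  define us where "us = takeWhile (\<lambda>t. fst_num t \<noteq> k) ts"
  define cs where "cs = dropWhile (\<lambda>t. fst_num t \<noteq> k) ts"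
  have ts: "ts = us @ cs" by (simp add: us_def cs_def)
  have P: "chain ts" "distinct (nums ts)" "set (nums ts) = A"
    using assms(1) by (auto simp: paths_def)
  have hd: "cs \<noteq> [] \<Longrightarrow> fst_num (hd cs) = k"
    using hd_dropWhile[of "\<lambda>t. fst_num t \<noteq> k" ts] by (simp add: cs_def)
  have "us \<noteq> [] \<and> (\<exists>b. last us = Boxed b k)" if "cs = []"
  proof -
    obtain t where t: "t \<in> set ts" "k \<in> set (token_nums t)"
      using assms(2) P(3) by (auto simp: set_nums)
    have "t \<in> set us" using t(1) that by (simp add: ts)
    then have "fst_num t \<noteq> k" unfolding us_def by (blast dest: set_takeWhileD)
    then obtain b where tb: "t = Boxed b k" using t(2) by (cases t) auto
    obtain p q where pq: "ts = p @ t # q" using t(1) by (meson split_list)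
    have "q = []"
    proof (cases q)
      case (Cons x q')
      then have "k < fst_num x" "fst_num x \<in> A"
        using P tb by (auto simp: pq successively_append_iff)
      then show ?thesis using assms(3) by auto
    qed
    then have "us = p @ [Boxed b k]" using ts that pq tb by simp
    then show ?thesis by simp
  qed
  moreover have "chain us" "chain cs" "distinct (nums us @ nums cs)" "set (nums us) \<union> set (nums cs) = A"
    using P unfolding ts by (simp_all add: successively_append_iff)
  ultimately show ?thesis using hd unfolding us_def[symmetric] cs_def[symmetric] splits_def by blast
qed

subsection \<open>Segments of a word\<close>

lemma segs_neq_Nil [simp]: "segs w \<noteq> []"
  by (induction w rule: segs.induct) auto

lemma segs_append_Box: "segs (u @ Box # v) = segs u @ segs v"
  by (induction u rule: segs.induct) auto

lemma segs_snoc_Num: "segs (w @ [Num a]) = butlast (segs w) @ [last (segs w) @ [a]]"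
proof (induction w rule: segs.induct)
  case (3 b w)
  then show ?case by (cases "segs w") auto
qed auto

lemma segs_rev: "segs (rev w) = rev (map rev (segs w))"
proof (induction w rule: segs.induct)
  case (2 w)
  then show ?case by (simp add: segs_append_Box)
next
  case (3 a w)
  then show ?case by (cases "segs w") (auto simp: segs_snoc_Num)
qed auto

lemma segs_map_Num: "segs (map Num xs) = [xs]"
  by (induction xs) auto

lemma sorted_segs_append:
  "\<forall>s\<in>set (segs (u @ v)). sorted_wrt R s \<Longrightarrow> \<forall>s\<in>set (segs v). sorted_wrt R s"
proof (induction u rule: segs.induct)
  case (3 a w)
  obtain s ss where "segs (w @ v) = s # ss" using segs_neq_Nil by (meson neq_Nil_conv)
  then have "\<forall>s\<in>set (segs (w @ v)). sorted_wrt R s" using "3.prems" by simp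
  then show ?case by (rule "3.IH")
qed simp_all

text \<open>The segment condition of \<open>BP\<close>, also imposed on box-free words.\<close>

definition path_segs :: "nat list list \<Rightarrow> bool" where
  "path_segs ss \<longleftrightarrow> hd ss \<noteq> [] \<and> last ss \<noteq> [] \<and> (\<forall>s\<in>set (butlast (tl ss)). 2 \<le> length s)
     \<and> (\<forall>s\<in>set ss. sorted_wrt (<) s)"

lemma path_segs_iff:
  assumes "ss \<noteq> []"
  shows "path_segs ss \<longleftrightarrow> length (hd ss) \<ge> 1 \<and> length (last ss) \<ge> 1
    \<and> (\<forall>i. 0 < i \<and> i + 1 < length ss \<longrightarrow> length (ss ! i) \<ge> 2)
    \<and> (\<forall>s\<in>set ss. sorted_wrt (<) s)"
proof -
  have "(\<forall>s\<in>set (butlast (tl ss)). 2 \<le> length s)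
    \<longleftrightarrow> (\<forall>i<length ss - 2. 2 \<le> length (ss ! Suc i))"
    by (auto simp: all_set_conv_all_nth nth_butlast nth_tl numeral_2_eq_2)
  also have "\<dots> \<longleftrightarrow> (\<forall>i. 0 < i \<and> i + 1 < length ss \<longrightarrow> length (ss ! i) \<ge> 2)"
  proof (intro iffI allI impI)
    fix i assume "\<forall>i<length ss - 2. 2 \<le> length (ss ! Suc i)" "0 < i \<and> i + 1 < length ss"
    then show "length (ss ! i) \<ge> 2" by (cases i) auto
  qed auto
  finally show ?thesis by (auto simp: path_segs_def Suc_le_eq)
qed

lemma hd_segs_word: "ts \<noteq> [] \<Longrightarrow> \<exists>s. hd (segs (word ts)) = fst_num (hd ts) # s"
proof (cases ts)
  case (Cons t us)
  then show ?thesis by (cases t) auto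
qed simp

lemma path_segs_Cons_Num:
  assumes "path_segs ss" "ss \<noteq> []" "a < hd (hd ss)"
  shows "path_segs ((a # hd ss) # tl ss)"
proof -
  obtain s rest where ss: "ss = s # rest" using assms(2) by (cases ss) auto
  obtain b s' where s: "s = b # s'" using assms(1) ss by (cases s) (auto simp: path_segs_def)
  show ?thesis using assms unfolding ss s by (auto simp: path_segs_def)
qed

text \<open>This is the effect of prefixing a number and a box. The old first segment becomes an
  inner one, and so needs length two, unless it is also the last.\<close>

lemma path_segs_Cons_sing:
  assumes "path_segs ss" "ss \<noteq> []" "2 \<le> length (hd ss) \<or> tl ss = []"
  shows "path_segs ([a] # ss)"
  using assms by (cases ss) (auto simp: path_segs_def)

text \<open>In the induction, the last number of the new token extends the first segment, which then
  has length at least two. Only then does a block add its singleton segment in front.\<close>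

lemma path_segs_word:
  assumes "ts \<noteq> []" "chain ts" "distinct (nums ts)"
  shows "path_segs (segs (word ts))"
  using assms
proof (induction ts)
  case (Cons t ts)
  show ?case
  proof (cases "ts = []")
    case True
    then show ?thesis by (cases t) (auto simp: path_segs_def)
  next
    case False
    then have IH: "path_segs (segs (word ts))" using Cons by (auto simp: successively_Cons)
    obtain s where s: "hd (segs (word ts)) = fst_num (hd ts) # s" using hd_segs_word[OF False] ..
    have "lst_num t < fst_num (hd ts)" using Cons.prems False by (simp add: successively_Cons)
    then have *: "path_segs ((lst_num t # hd (segs (word ts))) # tl (segs (word ts)))"
      using IH s by (intro path_segs_Cons_Num) auto
    show ?thesis
    proof (cases t)
      case (Free a)
      then show ?thesis using * by simp
    next
      case (Boxed a b)
      then show ?thesis using path_segs_Cons_sing[OF *, of a] s by simp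
    qed
  qed
qed simp

text \<open>Tokens are read off from the left: a number followed by a box opens a block, any other
  number is free. Blocks never overlap, because a number between two boxes would be an inner segment
  of length one.\<close>

lemma word_if_path_segs:
  assumes "path_segs (segs w)"
  shows "\<exists>ts. ts \<noteq> [] \<and> chain ts \<and> w = word ts"
  using assms
proof (induction "length w" arbitrary: w rule: less_induct)
  case less
  have single: "\<exists>ts. ts \<noteq> [] \<and> chain ts \<and> [Num a] = word ts" for a
    by (intro exI[of _ "[Free a]"]) simp
  \<comment> \<open>A number followed by a number is a free token; the recursion handles the word
    from the second number on.\<close>
  have num: "\<exists>ts. ts \<noteq> [] \<and> chain ts \<and> Num a # Num b # v = word (Free a # ts)
      \<and> chain (Free a # ts)"
    if ps: "path_segs (segs (Num a # Num b # v))" and len: "length (Num b # v) < length w" for a b v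
  proof -
    obtain s ss where v: "segs v = s # ss" using segs_neq_Nil[of v] by (cases "segs v") auto
    have "path_segs (segs (Num b # v))" "a < b"
      using ps v by (auto simp: path_segs_def)
    then obtain ts where ts: "ts \<noteq> []" "chain ts" "Num b # v = word ts"
      using less.hyps len by blast
    then have "fst_num (hd ts) = b" using hd_word[of ts] by (metis list.sel(1) sym.inject)
    then show ?thesis using ts \<open>a < b\<close> by (intro exI[of _ ts]) (auto simp: successively_Cons)
  qed
  show ?case
  proof (cases w)
    case Nil
    then show ?thesis using less.prems by (simp add: path_segs_def)
  next
    case (Cons x u)
    then obtain a where w: "w = Num a # u"
      using less.prems by (cases x) (auto simp: path_segs_def)
    consider "u = []" | b v where "u = Num b # v" | v where "u = Box # v"
      by (metis neq_Nil_conv sym.exhaust)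
    then show ?thesis
    proof cases
      case 1
      then show ?thesis using single w by simp
    next
      case (2 b v)
      then show ?thesis using num[of a b v] less.prems w by auto
    next
      case (3 v)
      obtain s ss where v: "segs v = s # ss" using segs_neq_Nil[of v] by (cases "segs v") auto
      have ps: "path_segs (s # ss)" "ss = [] \<or> 2 \<le> length s"
        using less.prems w 3 v by (auto simp: path_segs_def split: if_splits)
      then obtain b v' where v': "v = Num b # v'"
        using v by (cases v rule: segs.cases) (auto simp: path_segs_def)
      consider "v' = []" | v'' where "v' = Box # v''" | c v'' where "v' = Num c # v''"
        by (metis neq_Nil_conv sym.exhaust)
      then show ?thesis
      proof cases
        case 1
        then show ?thesis using w 3 v' by (intro exI[of _ "[Boxed a b]"]) simp
      next
        case (2 v'')
        then show ?thesis using ps v v' by auto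
      next
        case (3 c v'')
        have "path_segs (segs (Num b # Num c # v''))" using ps(1) v unfolding v' 3 by simp
        moreover have "length (Num c # v'') < length w" unfolding w \<open>u = Box # v\<close> v' 3 by simp
        ultimately obtain ts where ts: "Num b # Num c # v'' = word (Free b # ts)" "chain (Free b # ts)"
          using num by blast
        \<comment> \<open>The recursion has read \<open>b\<close> as a free token.
          \<open>Free b\<close> and \<open>Boxed a b\<close> have the same last number, so
          exchanging them at the front keeps the chain.\<close>
        then have "w = word (Boxed a b # ts)" unfolding w \<open>u = Box # v\<close> v' 3 by simp
        moreover have "chain (Boxed a b # ts)" using ts(2) by (simp add: successively_Cons)
        ultimately show ?thesis by blast
      qed
    qed
  qed
qed

section \<open>Box-permutations as words of token sequences\<close>

lemma Box_free_word: "Box \<notin> set (word ts) \<Longrightarrow> word ts = map Num (nums ts)"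
proof (induction ts)
  case (Cons t ts)
  then show ?case by (cases t) auto
qed simp

lemma chain_Box_free_sorted:
  assumes "chain ts" "Box \<notin> set (word ts)"
  shows "sorted_wrt (<) (nums ts)"
proof (cases "ts = []")
  case False
  have "\<forall>t\<in>set ts. \<exists>a. t = Free a"
  proof
    fix t assume "t \<in> set ts"
    then obtain p q where "ts = p @ t # q" by (meson split_list)
    then show "\<exists>a. t = Free a" using assms(2) by (cases t) auto
  qed
  then have "successively (<) (nums ts)"
    using assms(1)
  proof (induction ts)
    case (Cons t ts)
    then obtain a where t: "t = Free a" by auto
    show ?case
    proof (cases ts)
      case (Cons u us)
      then obtain b where "u = Free b" using Cons.prems by auto
      then show ?thesis using Cons.IH Cons.prems t Cons by auto
    qed (use t in simp)
  qed simp
  then show ?thesis by (simp add: successively_conv_sorted_wrt)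
qed simp

lemma distinct_nums_iff_count:
  "distinct (nums ts) \<and> set (nums ts) = A \<longleftrightarrow>
    set (word ts) \<subseteq> insert Box (Num ` A) \<and> (\<forall>a\<in>A. count_list (word ts) (Num a) = 1)"
proof (intro iffI conjI; (elim conjE)?)
  assume *: "set (word ts) \<subseteq> insert Box (Num ` A)" "\<forall>a\<in>A. count_list (word ts) (Num a) = 1"
  have sub: "set (nums ts) \<subseteq> A"
  proof
    fix a assume "a \<in> set (nums ts)"
    then have "Num a \<in> insert Box (Num ` A)" using *(1) Num_in_word by blast
    then show "a \<in> A" by auto
  qed
  moreover have "A \<subseteq> set (nums ts)"
  proof
    fix a assume "a \<in> A"
    then have "count_list (nums ts) a = 1" using *(2) by (simp add: count_word)
    then show "a \<in> set (nums ts)" by (metis count_notin zero_neq_one)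
  qed
  ultimately show "set (nums ts) = A" by blast
  show "distinct (nums ts)" using *(2) sub
    by (intro distinct_if_count_list_1) (auto simp: count_word)
next
  assume "distinct (nums ts)" "set (nums ts) = A"
  then show "\<forall>a\<in>A. count_list (word ts) (Num a) = 1"
    by (auto simp: count_word count_list_distinct)
  show "set (word ts) \<subseteq> insert Box (Num ` A)" using set_word[of ts] \<open>set (nums ts) = A\<close> by simp
qed

text \<open>A nonempty box-free word of \<open>BP A\<close> is one increasing segment, so
  \<open>path_segs\<close> covers it as well. The empty word fails \<open>path_segs\<close> and is
  treated apart. Conversely, a box-free chain is strictly increasing and must be the sorted list of
  \<open>A\<close>.\<close>

lemma BP_eq_word_paths:
  assumes "finite A"
  shows "BP A = word ` paths A"
proof (intro equalityI subsetI)
  fix w assume "w \<in> BP A"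
  then have w: "set w \<subseteq> insert Box (Num ` A)" "\<forall>a\<in>A. count_list w (Num a) = 1"
      "Box \<notin> set w \<Longrightarrow> w = map Num (sorted_list_of_set A)"
      "Box \<in> set w \<Longrightarrow> path_segs (segs w)"
    by (auto simp: BP_def Let_def path_segs_iff)
  have "\<exists>ts. chain ts \<and> w = word ts"
  proof (cases "w = []")
    case True
    then show ?thesis by (intro exI[of _ "[]"]) simp
  next
    case False
    then have "path_segs (segs w)"
      using w(3,4) assms by (cases "Box \<in> set w") (auto simp: segs_map_Num path_segs_def)
    then show ?thesis using word_if_path_segs by blast
  qed
  then show "w \<in> word ` paths A"
    using w(1,2) distinct_nums_iff_count unfolding paths_def by blast
next
  fix w assume "w \<in> word ` paths A"
  then obtain ts where ts: "w = word ts" "chain ts" "distinct (nums ts)" "set (nums ts) = A"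
    by (auto simp: paths_def)
  then have 1: "set w \<subseteq> insert Box (Num ` A)" "\<forall>a\<in>A. count_list w (Num a) = 1"
    using distinct_nums_iff_count[of ts A] by auto
  have 2: "w = map Num (sorted_list_of_set A)" if "Box \<notin> set w"
  proof -
    have "nums ts = sorted_list_of_set A"
      using chain_Box_free_sorted[of ts] ts that assms
      by (intro strict_sorted_equal) auto
    then show ?thesis using Box_free_word[of ts] ts(1) that by simp
  qed
  have 3: "path_segs (segs w)" if "Box \<in> set w"
    using path_segs_word[of ts] ts that by (cases "ts = []") auto
  show "w \<in> BP A" using 1 2 3 by (simp add: BP_def Let_def path_segs_iff)
qed

section \<open>Box neighbours of a word\<close>

definition has_box :: "sym list \<Rightarrow> nat \<Rightarrow> nat \<Rightarrow> bool" where
  "has_box w a b \<longleftrightarrow> (\<exists>u v. w = u @ Num a # Box # Num b # v)"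

lemma has_box_Cons:
  "has_box (x # w) a b \<longleftrightarrow> has_box w a b \<or> (\<exists>v. x = Num a \<and> w = Box # Num b # v)"
  unfolding has_box_def by (auto simp: Cons_eq_append_conv)

lemma box_nbrs_eq: "box_nbrs w = {{a, b} | a b. has_box w a b}"
proof (intro equalityI subsetI)
  fix x assume "x \<in> box_nbrs w"
  then obtain a b i where x: "x = {a, b}" "0 < i" "i + 1 < length w" "w ! i = Box"
      "w ! (i - 1) = Num a" "w ! (i + 1) = Num b"
    by (auto simp: box_nbrs_def)
  obtain j where i: "i = Suc j" using x(2) by (cases i) auto
  have "w = take j w @ w ! j # w ! Suc j # w ! Suc (Suc j) # drop (Suc (Suc (Suc j))) w"
    using x(3) i by (simp add: Cons_nth_drop_Suc)
  then have "has_box w a b"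
    using x i by (auto simp: has_box_def)
  then show "x \<in> {{a, b} | a b. has_box w a b}" using x(1) by blast
next
  fix x assume "x \<in> {{a, b} | a b. has_box w a b}"
  then obtain a b u v where x: "x = {a, b}" "w = u @ Num a # Box # Num b # v"
    by (auto simp: has_box_def)
  have "w ! Suc (length u) = Box" "w ! (Suc (length u) - 1) = Num a" "w ! (Suc (length u) + 1) = Num b"
    "Suc (length u) + 1 < length w" by (simp_all add: x(2) nth_append)
  then show "x \<in> box_nbrs w" unfolding box_nbrs_def x(1) by blast
qed

lemma box_nbrs_Num_Num: "box_nbrs (Num a # Num b # w) = box_nbrs (Num b # w)"
  unfolding box_nbrs_eq by (simp add: has_box_Cons)

lemma box_nbrs_Num_Box: "box_nbrs (Num a # Box # Num b # w) = insert {a, b} (box_nbrs (Num b # w))"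
  unfolding box_nbrs_eq by (auto simp: has_box_Cons)

lemma box_nbrs_single: "box_nbrs [Num a] = {}" "box_nbrs [] = {}"
  by (auto simp: box_nbrs_def)

lemma box_nbrs_word: "box_nbrs (word ts) = nbrs ts"
proof (induction ts)
  case (Cons t ts)
  have *: "box_nbrs (Num a # word ts) = nbrs ts" for a
  proof (cases "ts = []")
    case False
    then obtain b w where "word ts = Num b # w"
      using hd_word[of ts] by (cases "word ts") auto
    then show ?thesis using Cons by (simp add: box_nbrs_Num_Num)
  qed (simp add: box_nbrs_single)
  show ?case by (cases t) (auto simp: * box_nbrs_Num_Box nbrs_def)
qed (simp add: box_nbrs_single)

subsection \<open>Rotation and reversal of cycles\<close>

lemma rotate_inverse: "\<exists>m. rotate m (rotate n c) = c"
proof (cases "c = []")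
  case False
  let ?m = "length c - n mod length c"
  have "?m + n mod length c = length c" using False by (simp add: less_imp_le)
  then have "(?m + n) mod length c = 0" by (metis mod_add_right_eq mod_self)
  then have "rotate ?m (rotate n c) = c"
    by (subst rotate_rotate, subst rotate_conv_mod) simp
  then show ?thesis ..
qed simp

lemma cyc_rotate [simp]: "cyc (rotate n c) = cyc c"
proof -
  have sub: "cyc (rotate n c) \<subseteq> cyc c" for n c by (auto simp: cyc_def rotate_rotate)
  obtain m where "rotate m (rotate n c) = c" using rotate_inverse by blast
  then show ?thesis using sub[of n c] sub[of m "rotate n c"] by simp
qed

lemma self_in_cyc: "c \<in> cyc c"
  unfolding cyc_def by (metis rangeI rotate0 id_apply)

lemma Union_set_cyc [simp]: "\<Union> (set ` cyc c) = set c"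
  by (auto simp: cyc_def)

lemma rev_rotate: "\<exists>m. rotate n (rev c) = rev (rotate m c)"
  by (metis rotate_rev)

lemma cyc_rev: "cyc (rev c) = rev ` cyc c"
proof -
  have sub: "cyc (rev c) \<subseteq> rev ` cyc c" for c
    using rev_rotate[of _ c] unfolding cyc_def by blast
  have "rev ` cyc c \<subseteq> rev ` rev ` cyc (rev c)" using sub[of "rev c"] by auto
  then show ?thesis using sub[of c] by (auto simp: image_image)
qed

lemma count_list_rotate [simp]: "count_list (rotate n c) x = count_list c x"
proof -
  define m where "m = n mod length c"
  have "count_list c x = count_list (take m c @ drop m c) x" by simp
  also have "\<dots> = count_list (rotate n c) x"
    unfolding rotate_drop_take m_def[symmetric] count_list_append by simp
  finally show ?thesis ..
qed

text \<open>Cutting the cycle at another box writes \<open>w\<close> as \<open>x @ Box # d\<close>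
  and \<open>v\<close> as \<open>d @ Box # x\<close>, which have the same segments in a different
  order. The run condition can thus be checked at a single box.\<close>

lemma set_segs_rotate:
  assumes "rotate n (Box # w) = Box # v"
  shows "set (segs v) = set (segs w)"
proof -
  define m where "m = n mod length (Box # w)"
  have eq: "drop m (Box # w) @ take m (Box # w) = Box # v"
    using assms by (simp only: rotate_drop_take m_def)
  show ?thesis
  proof (cases m)
    case 0
    then show ?thesis using eq by simp
  next
    case (Suc j)
    have "m < length (Box # w)" unfolding m_def by (rule mod_less_divisor) simp
    then have "j < length w" using Suc by simp
    then obtain y d where d: "drop j w = y # d" by (metis Cons_nth_drop_Suc)
    have v: "y = Box" "v = d @ Box # take j w" using eq Suc d by auto
    have "w = take j w @ Box # d" using d v(1) by (metis append_take_drop_id)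
    then have "segs w = segs (take j w) @ segs d" by (metis segs_append_Box)
    then show ?thesis by (auto simp: v(2) segs_append_Box)
  qed
qed

definition runs_ok :: "(nat \<Rightarrow> nat \<Rightarrow> bool) \<Rightarrow> sym list \<Rightarrow> bool" where
  "runs_ok R c \<longleftrightarrow>
    (\<forall>n v. rotate n c = Box # v \<longrightarrow> (\<forall>s\<in>set (segs v). 2 \<le> length s \<and> sorted_wrt R s))"

lemma runs_ok_rotate_Box:
  assumes "\<forall>s\<in>set (segs v). 2 \<le> length s \<and> sorted_wrt R s" "rotate m c = Box # v"
  shows "runs_ok R c"
  unfolding runs_ok_def
proof (intro allI impI)
  fix n u assume u: "rotate n c = Box # u"
  obtain l where "rotate l (rotate m c) = c" using rotate_inverse by blast
  then have "rotate (n + l) (Box # v) = Box # u" using u assms(2) by (metis rotate_rotate)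
  then show "\<forall>s\<in>set (segs u). 2 \<le> length s \<and> sorted_wrt R s"
    using assms(1) set_segs_rotate by metis
qed

text \<open>With the first of two adjacent boxes rotated to the front, the remaining word has an
  empty first segment, against the bound two.\<close>

lemma runs_ok_no_adjacent_boxes:
  assumes "runs_ok R c" "i < length c" "c ! i = Box" "2 \<le> length c"
  shows "c ! ((i + 1) mod length c) \<noteq> Box"
proof
  assume *: "c ! ((i + 1) mod length c) = Box"
  have nth: "rotate i c ! 0 = Box" "rotate i c ! 1 = Box"
    using assms * by (subst nth_rotate; force)+
  moreover have "length (rotate i c) \<ge> 2" using assms by simp
  ultimately obtain v where "rotate i c = Box # Box # v"
    by (cases "rotate i c" rule: remdups_adj.cases) auto
  then have "\<forall>s\<in>set (segs (Box # v)). 2 \<le> length s \<and> sorted_wrt R s"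
    using assms(1) unfolding runs_ok_def by blast
  then show False by simp
qed

lemma box_cycle_gen_iff:
  "box_cycle_gen R A c \<longleftrightarrow> (\<exists>a\<in>A. c = [Num a])
   \<or> (odd (length c) \<and> length c \<ge> 3 \<and> set c \<subseteq> insert Box (Num ` A)
      \<and> (\<forall>a\<in>A. count_list c (Num a) \<le> 1) \<and> Box \<in> set c \<and> runs_ok R c)"
proof -
  have "\<forall>i<length c. \<not> (c ! i = Box \<and> c ! ((i + 1) mod length c) = Box)"
    if "runs_ok R c" "length c \<ge> 3"
    using runs_ok_no_adjacent_boxes[OF that(1)] that(2) by auto
  then show ?thesis unfolding box_cycle_gen_def runs_ok_def[symmetric] by blast
qed

lemma box_cycle_gen_mono:
  assumes "box_cycle_gen R B c" "B \<subseteq> A"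
  shows "box_cycle_gen R A c"
proof -
  have "count_list c (Num a) \<le> 1"
    if "\<forall>a\<in>B. count_list c (Num a) \<le> 1" "set c \<subseteq> insert Box (Num ` B)" for a
  proof (cases "a \<in> B")
    case False
    then have "Num a \<notin> set c" using that(2) by auto
    then show ?thesis by simp
  qed (use that in auto)
  then show ?thesis using assms unfolding box_cycle_gen_iff by blast
qed

lemma box_cycle_gen_restrict:
  assumes "box_cycle_gen R A c" "B \<subseteq> A" "set c \<subseteq> insert Box (Num ` B)"
  shows "box_cycle_gen R B c"
  using assms unfolding box_cycle_gen_iff by auto

lemma box_cycle_gen_set: "box_cycle_gen R A c \<Longrightarrow> set c \<subseteq> insert Box (Num ` A)"
  unfolding box_cycle_gen_iff by auto

lemma runs_ok_rev:
  assumes "runs_ok R c"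
  shows "runs_ok (\<lambda>x y. R y x) (rev c)"
  unfolding runs_ok_def
proof (intro allI impI)
  fix n v assume "rotate n (rev c) = Box # v"
  then obtain m where "rev (rotate m c) = Box # v" using rev_rotate by metis
  then have "rotate m c = rev v @ [Box]" by (simp add: rev_swap)
  \<comment> \<open>The reversal has put the cutting box at the end; a further rotation brings it
    back to the front.\<close>
  then have "rotate (length v + m) c = Box # rev v"
    by (metis append_Cons append_Nil length_rev rotate_append rotate_rotate)
  then have "\<forall>s\<in>set (segs (rev v)). 2 \<le> length s \<and> sorted_wrt R s"
    using assms unfolding runs_ok_def by blast
  then show "\<forall>s\<in>set (segs v). 2 \<le> length s \<and> sorted_wrt (\<lambda>x y. R y x) s"
    by (simp add: segs_rev sorted_wrt_rev)
qed

lemma box_cycle_gen_rev: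
  assumes "box_cycle_gen R A c"
  shows "box_cycle_gen (\<lambda>x y. R y x) A (rev c)"
  using assms runs_ok_rev[of R c] unfolding box_cycle_gen_iff by auto

lemma cyc_box_nbrs_eq:
  assumes "length c \<ge> 3"
  shows "cyc_box_nbrs c = {{a, b} | a b. \<exists>n v. rotate n c = Num a # Box # Num b # v}"
proof (intro equalityI subsetI)
  fix x assume "x \<in> cyc_box_nbrs c"
  then obtain a b i where x: "x = {a, b}" "i < length c" "c ! i = Box"
    "c ! ((i + length c - 1) mod length c) = Num a" "c ! ((i + 1) mod length c) = Num b"
    by (auto simp: cyc_box_nbrs_def)
  \<comment> \<open>Modulo the length this is the position before the box, written so that
    subtraction does not truncate at \<open>i = 0\<close>.\<close>
  define n where "n = i + length c - 1"
  have "rotate n c ! 0 = Num a" using x assms unfolding n_def by (subst nth_rotate) auto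
  have "n + 1 = i + length c" using assms by (simp add: n_def)
  then have "(n + 1) mod length c = i" using x(2) by (metis mod_add_self2 mod_less)
  then have "rotate n c ! 1 = Box" using x assms by (subst nth_rotate) auto
  have "n + 2 = i + 1 + length c" using assms by (simp add: n_def)
  then have "(n + 2) mod length c = (i + 1) mod length c" by (metis mod_add_self2)
  then have "rotate n c ! 2 = Num b" using x assms by (subst nth_rotate) auto
  moreover have "length (rotate n c) \<ge> 3" using assms by simp
  then obtain y0 y1 y2 v where "rotate n c = y0 # y1 # y2 # v"
    by (metis Suc_le_length_iff numeral_3_eq_3)
  ultimately have "rotate n c = Num a # Box # Num b # v"
    using \<open>rotate n c ! 0 = Num a\<close> \<open>rotate n c ! 1 = Box\<close> by simp
  then show "x \<in> {{a, b} | a b. \<exists>n v. rotate n c = Num a # Box # Num b # v}"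
    using x(1) by blast
next
  fix x assume "x \<in> {{a, b} | a b. \<exists>n v. rotate n c = Num a # Box # Num b # v}"
  then obtain a b n v where x: "x = {a, b}" "rotate n c = Num a # Box # Num b # v" by blast
  define i where "i = (n + 1) mod length c"
  have "c ! (n mod length c) = Num a"
    using nth_rotate[of 0 c n] assms x(2) by (cases c) auto
  moreover have "(i + length c - 1) mod length c = n mod length c"
  proof -
    have "i + length c - 1 = i + (length c - 1)" using assms by simp
    also have "\<dots> mod length c = (n + 1 + (length c - 1)) mod length c"
      unfolding i_def by (rule mod_add_left_eq)
    also have "n + 1 + (length c - 1) = n + length c" using assms by simp
    finally show ?thesis by simp
  qed
  moreover have "c ! i = Box"
    using nth_rotate[of 1 c n] assms x(2) by (auto simp: i_def)
  moreover have "c ! ((n + 2) mod length c) = Num b"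
    using nth_rotate[of 2 c n] assms x(2) by auto
  moreover have "(i + 1) mod length c = (n + 2) mod length c"
    unfolding i_def by (simp add: mod_Suc_eq)
  moreover have "i < length c" using assms by (auto simp: i_def intro!: mod_less_divisor)
  ultimately have "i < length c" "c ! i = Box" "c ! ((i + length c - 1) mod length c) = Num a"
    "c ! ((i + 1) mod length c) = Num b" by simp_all
  then show "x \<in> cyc_box_nbrs c"
    unfolding cyc_box_nbrs_def x(1) by blast
qed

lemma cyc_box_nbrs_rotate:
  assumes "length c \<ge> 3"
  shows "cyc_box_nbrs (rotate m c) = cyc_box_nbrs c"
proof -
  have sub: "cyc_box_nbrs (rotate m c) \<subseteq> cyc_box_nbrs c" if "length c \<ge> 3" for m c
    using that by (auto simp: cyc_box_nbrs_eq rotate_rotate)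
  obtain l where "rotate l (rotate m c) = c" using rotate_inverse by blast
  then show ?thesis using sub[of c m] sub[of "rotate m c" l] assms by auto
qed

text \<open>Reversal exchanges the two neighbours of a box, which the unordered pair does not
  see.\<close>

lemma cyc_box_nbrs_rev:
  assumes "length c \<ge> 3"
  shows "cyc_box_nbrs (rev c) = cyc_box_nbrs c"
proof -
  have sub: "cyc_box_nbrs (rev c) \<subseteq> cyc_box_nbrs c" if c: "length c \<ge> 3" for c
  proof
    fix x assume "x \<in> cyc_box_nbrs (rev c)"
    then obtain a b n v where x: "x = {a, b}" "rotate n (rev c) = Num a # Box # Num b # v"
      using c by (auto simp: cyc_box_nbrs_eq)
    then obtain m where "rev (rotate m c) = Num a # Box # Num b # v" using rev_rotate by metis
    then have "rotate m c = rev v @ [Num b, Box, Num a]" by (simp add: rev_swap)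
    then have "rotate (length v + m) c = Num b # Box # Num a # rev v"
      by (metis append_Cons append_Nil length_rev rotate_append rotate_rotate)
    then show "x \<in> cyc_box_nbrs c" using c x(1) by (auto simp: cyc_box_nbrs_eq insert_commute)
  qed
  show ?thesis using sub[of c] sub[of "rev c"] assms by auto
qed

text \<open>A word begins and ends with a number, so every box is interior and closing the word to a
  cycle gives no box a new neighbour.\<close>

lemma cyc_box_nbrs_word:
  assumes "cs \<noteq> []"
  shows "cyc_box_nbrs (word cs) = nbrs cs"
proof -
  let ?c = "word cs"
  have ne: "?c \<noteq> []" using assms by simp
  have ends: "?c ! 0 \<noteq> Box" "?c ! (length ?c - 1) \<noteq> Box"
    using hd_word[OF assms] last_word[OF assms] ne by (simp_all add: hd_conv_nth last_conv_nth)
  have inner: "0 < i \<and> i + 1 < length ?c" if "i < length ?c" "?c ! i = Box" for i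
  proof -
    have "i \<noteq> 0" "i \<noteq> length ?c - 1" using ends that by metis+
    then show ?thesis using that by linarith
  qed
  have mods: "(i + length ?c - 1) mod length ?c = i - 1" "(i + 1) mod length ?c = i + 1"
    if "0 < i" "i + 1 < length ?c" for i
  proof -
    have eq: "i + length ?c - 1 = i - 1 + length ?c" using that by simp
    show "(i + length ?c - 1) mod length ?c = i - 1"
      unfolding eq mod_add_self2 using that by simp
  qed (use that in simp)
  have "cyc_box_nbrs ?c = box_nbrs ?c"
  proof (intro equalityI subsetI)
    fix x assume "x \<in> cyc_box_nbrs ?c"
    then obtain a b i where i: "x = {a, b}" "i < length ?c" "?c ! i = Box"
      "?c ! ((i + length ?c - 1) mod length ?c) = Num a" "?c ! ((i + 1) mod length ?c) = Num b"
      by (auto simp: cyc_box_nbrs_def)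
    then show "x \<in> box_nbrs ?c"
      using inner[OF i(2,3)] mods[of i] unfolding box_nbrs_def by (intro CollectI exI conjI) auto
  next
    fix x assume "x \<in> box_nbrs ?c"
    then obtain a b i where i: "x = {a, b}" "0 < i" "i + 1 < length ?c" "?c ! i = Box"
      "?c ! (i - 1) = Num a" "?c ! (i + 1) = Num b"
      by (auto simp: box_nbrs_def)
    then show "x \<in> cyc_box_nbrs ?c"
      using mods[OF i(2,3)] unfolding cyc_box_nbrs_def by (intro CollectI exI conjI) auto
  qed
  then show ?thesis by (simp add: box_nbrs_word)
qed

subsection \<open>Cycles through the maximum\<close>

text \<open>For \<open>k\<close> the maximum of \<open>A\<close>, these are the odd box-cycles
  through \<open>k\<close>, cut open just before \<open>k\<close>; see
  \<open>box_cycle_gen_word\<close> and \<open>box_cycle_gen_normal_form\<close>.\<close>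

definition loops :: "nat set \<Rightarrow> nat \<Rightarrow> token list set" where
  "loops A k = {cs. cs \<noteq> [] \<and> fst_num (hd cs) = k \<and> chain cs \<and> distinct (nums cs)
     \<and> set (nums cs) \<subseteq> A \<and> odd (length cs)}"

text \<open>The token after \<open>Free k\<close> would start with a number above the
  maximum.\<close>

lemma loops_Free:
  assumes "Free k # cs \<in> loops A k" "\<forall>a\<in>A. a \<le> k"
  shows "cs = []"
proof (cases cs)
  case (Cons t us)
  then have "k < fst_num t" "fst_num t \<in> A" using assms(1) by (auto simp: loops_def)
  then show ?thesis using assms(2) by auto
qed

lemma loops_cases:
  assumes "cs \<in> loops A k" "\<forall>a\<in>A. a \<le> k"
  obtains "cs = [Free k]" | b vs where "cs = Boxed k b # vs"
proof (cases cs)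
  case Nil
  then show ?thesis using assms(1) by (simp add: loops_def)
next
  case (Cons t us)
  then show ?thesis using assms that loops_Free[of k us A]
    by (cases t) (auto simp: loops_def)
qed

text \<open>This is the cycle of \<open>Boxed k b # vs\<close> cut at its first box, with
  \<open>k\<close> wrapped round to the end. The first segment holds \<open>b\<close> and the start
  of the next token, and the last one gains \<open>k\<close>, so both reach length two; inner
  segments are covered by \<open>path_segs\<close>.\<close>

lemma long_segs_word:
  assumes "chain (Free b # vs @ [Free k])" "distinct (nums (Free b # vs @ [Free k]))"
  shows "\<forall>s\<in>set (segs (word (Free b # vs @ [Free k]))). 2 \<le> length s \<and> sorted_wrt (<) s"
proof -
  let ?ws = "vs @ [Free k]"
  have ps: "path_segs (segs (word (Free b # ?ws)))" using assms by (intro path_segs_word) auto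
  obtain s where s: "hd (segs (word ?ws)) = fst_num (hd ?ws) # s" using hd_segs_word[of ?ws] by auto
  have segs: "segs (word (Free b # ?ws)) = (b # hd (segs (word ?ws))) # tl (segs (word ?ws))" by simp
  have len: "2 \<le> length t" if t: "t \<in> set (segs (word (Free b # ?ws)))" for t
  proof -
    let ?us = "segs (word (Free b # vs))"
    have "segs (word (Free b # ?ws)) = butlast ?us @ [last ?us @ [k]]"
      by (metis append_Cons segs_snoc_Num token_word.simps(1) word_simps(1,2,3) append_Nil2)
    moreover have "chain (Free b # vs)" using assms(1) by (metis append_Cons successively_append_iff)
    then have "last ?us \<noteq> []"
      using path_segs_word[of "Free b # vs"] assms(2) unfolding path_segs_def by auto
    ultimately have last: "2 \<le> length (last (segs (word (Free b # ?ws))))"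
      by (cases "last ?us") auto
    have first: "2 \<le> length (hd (segs (word (Free b # ?ws))))" using s segs by simp
    let ?ss = "segs (word (Free b # ?ws))"
    have "t = hd ?ss \<or> t = last ?ss \<or> t \<in> set (butlast (tl ?ss))"
      using t by (cases ?ss; cases "tl ?ss" rule: rev_cases) auto
    then show ?thesis using first last ps unfolding path_segs_def by blast
  qed
  then show ?thesis using ps unfolding path_segs_def by blast
qed

lemma box_cycle_gen_word:
  assumes "cs \<in> loops A k" "\<forall>a\<in>A. a \<le> k"
  shows "box_cycle_gen (<) A (word cs)"
  using assms
proof (cases rule: loops_cases)
  case 1
  then show ?thesis using assms(1) by (auto simp: loops_def box_cycle_gen_iff)
next
  case (2 b vs)
  have L: "chain cs" "distinct (nums cs)" "set (nums cs) \<subseteq> A" "odd (length cs)"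
    using assms(1) by (auto simp: loops_def)
  let ?ds = "Free b # vs @ [Free k]"
  have "lst_num (last (Free b # vs)) \<in> set (nums (Free b # vs))"
    unfolding set_nums by (rule UN_I[OF last_in_set]) simp_all
  then have "lst_num (last (Free b # vs)) < k"
    using L(2,3) assms(2) unfolding 2 by (auto simp: order.strict_iff_order simp del: last.simps)
  moreover have "chain (Free b # vs)" using L(1) unfolding 2 by (simp add: successively_Cons)
  ultimately have "chain ?ds" using successively_append_iff[of _ "Free b # vs" "[Free k]"] by auto
  moreover have "distinct (nums ?ds)" using L(2) unfolding 2 by auto
  ultimately have "\<forall>s\<in>set (segs (word ?ds)). 2 \<le> length s \<and> sorted_wrt (<) s"
    by (rule long_segs_word)
  moreover have "rotate 1 (word cs) = Box # word ?ds" unfolding 2 by simp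
  ultimately have "runs_ok (<) (word cs)" by (rule runs_ok_rotate_Box)
  moreover have "count_list (word cs) (Num a) \<le> 1" for a
    using L(2) count_list_distinct[of "nums cs" a]
    by (cases "a \<in> set (nums cs)") (auto simp: count_word)
  moreover have "set (word cs) \<subseteq> insert Box (Num ` A)" using set_word[of cs] L(3) by blast
  ultimately show ?thesis
    using L(4) odd_length_word[of cs] unfolding box_cycle_gen_iff by (auto simp: 2)
qed

text \<open>The maximum ends its increasing run, so a box follows it. With that box in front and
  \<open>k\<close> at the end, the word between them is read as tokens; joining \<open>k\<close>,
  the box and the first number into one block gives the loop.\<close>

lemma box_cycle_gen_normal_form:
  assumes c: "box_cycle_gen (<) A c" and k: "Num k \<in> set c" and max: "\<forall>a\<in>A. a \<le> k"
  shows "\<exists>cs\<in>loops A k. \<exists>n. word cs = rotate n c"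
proof (cases "\<exists>a\<in>A. c = [Num a]")
  case True
  then show ?thesis using k by (intro bexI[of _ "[Free k]"] exI[of _ 0]) (auto simp: loops_def)
next
  case False
  then have C: "odd (length c)" "set c \<subseteq> insert Box (Num ` A)" "\<forall>a\<in>A. count_list c (Num a) \<le> 1"
    "Box \<in> set c" "runs_ok (<) c"
    using c by (auto simp: box_cycle_gen_iff)
  obtain p q where c_eq: "c = p @ Box # q" using C(4) by (meson split_list)
  have rot: "rotate (length p) c = Box # q @ p" using rotate_append[of p "Box # q"] by (simp add: c_eq)
  have "Num k \<in> set (q @ p)" using k c_eq by auto
  then obtain r1 r2 where r: "q @ p = r1 @ Num k # r2" by (meson split_list)
  have "\<exists>n v. rotate n c = Box # v @ [Num k]"
  proof (cases r2)
    case Nil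
    then have "rotate (length p) c = Box # r1 @ [Num k]" using rot r by simp
    then show ?thesis by blast
  next
    case (Cons x r3)
    show ?thesis
    proof (cases x)
      case Box
      have "rotate (length (Box # r1 @ [Num k])) ((Box # r1 @ [Num k]) @ Box # r3)
          = Box # (r3 @ Box # r1) @ [Num k]"
        by (subst rotate_append) simp
      moreover have "rotate (length p) c = (Box # r1 @ [Num k]) @ Box # r3"
        using rot r Cons Box by simp
      ultimately have "rotate (length (Box # r1 @ [Num k]) + length p) c = Box # (r3 @ Box # r1) @ [Num k]"
        by (simp only: rotate_rotate[symmetric])
      then show ?thesis by blast
    next
      case (Num b)
      \<comment> \<open>A number right after \<open>k\<close> in the same run would exceed
        \<open>k\<close>.\<close>
      have "\<forall>s\<in>set (segs (r1 @ Num k # Num b # r3)). sorted_wrt (<) s"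
        using C(5) rot unfolding r Cons Num runs_ok_def by blast
      then have "\<forall>s\<in>set (segs (Num k # Num b # r3)). sorted_wrt (<) s" by (rule sorted_segs_append)
      then have "k < b" by simp
      moreover have "Num b \<in> set (q @ p)" unfolding r Cons Num by simp
      then have "Num b \<in> insert Box (Num ` A)" using C(2) c_eq by auto
      then have "b \<in> A" by auto
      ultimately show ?thesis using max by auto
    qed
  qed
  then obtain n v where nv: "rotate n c = Box # v @ [Num k]" by blast
  then have runs: "\<forall>s\<in>set (segs (v @ [Num k])). 2 \<le> length s \<and> sorted_wrt (<) s"
    using C(5) unfolding runs_ok_def by blast
  have seg_mem: "2 \<le> length (hd (segs (v @ [Num k])))" "2 \<le> length (last (segs (v @ [Num k])))"
    using runs by simp_all
  have "path_segs (segs (v @ [Num k]))"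
  proof -
    have "set (butlast (tl (segs (v @ [Num k])))) \<subseteq> set (segs (v @ [Num k]))"
      by (cases "segs (v @ [Num k])") (auto dest: in_set_butlastD)
    moreover have "hd (segs (v @ [Num k])) \<noteq> []" "last (segs (v @ [Num k])) \<noteq> []"
      using seg_mem by auto
    ultimately show ?thesis unfolding path_segs_def using runs by blast
  qed
  then obtain ts where ts: "ts \<noteq> []" "chain ts" "v @ [Num k] = word ts"
    using word_if_path_segs by blast
  obtain us t where us: "ts = us @ [t]" using ts(1) by (metis rev_exhaust)
  \<comment> \<open>A final block would leave a last run of length one; likewise an initial block
    would leave a first run of length one.\<close>
  have t: "t = Free k"
  proof (cases t)
    case (Free a)
    then show ?thesis using ts(3) us by simp
  next
    case (Boxed a b)
    then have "v @ [Num k] = (word us @ [Num a]) @ Box # [Num b]" using ts(3) us by simp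
    then have "segs (v @ [Num k]) = segs (word us @ [Num a]) @ segs [Num b]"
      by (metis segs_append_Box)
    then show ?thesis using seg_mem(2) by simp
  qed
  then have v: "v = word us" using ts(3) us by simp
  have "us \<noteq> []" using seg_mem(1) v by auto
  then obtain t' vs where us': "us = t' # vs" by (meson list.exhaust)
  obtain b where t': "t' = Free b"
    using seg_mem(1) unfolding v us' by (cases t') auto
  let ?cs = "Boxed k b # vs"
  have "rotate (length (Box # v) + n) c = Num k # Box # v"
    using rotate_append[of "Box # v" "[Num k]"] nv
    by (metis append_Cons append_Nil rotate_rotate)
  then have w: "word ?cs = rotate (length (Box # v) + n) c" by (simp add: v us' t')
  have count: "count_list (nums ?cs) a = count_list c (Num a)" for a
    unfolding count_word[symmetric] w by (rule count_list_rotate)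
  have sub: "set (nums ?cs) \<subseteq> A"
  proof
    fix a assume "a \<in> set (nums ?cs)"
    then have "Num a \<in> set (word ?cs)" by (simp only: Num_in_word)
    then have "Num a \<in> insert Box (Num ` A)" using C(2) unfolding w set_rotate by blast
    then show "a \<in> A" by auto
  qed
  have "distinct (nums ?cs)"
  proof (rule distinct_if_count_list_1)
    fix a assume a: "a \<in> set (nums ?cs)"
    then have "count_list (nums ?cs) a \<noteq> 0" by (simp only: count_list_0_iff not_not)
    moreover have "count_list (nums ?cs) a \<le> 1" using a sub C(3) unfolding count by blast
    ultimately show "count_list (nums ?cs) a = 1" by linarith
  qed
  moreover have "chain (Free b # vs)"
    using ts(2) unfolding us us' t' by (metis successively_append_iff)
  then have "chain ?cs" by (simp add: successively_Cons)
  moreover have "odd (length ?cs)" using C(1) odd_length_word[of ?cs] unfolding w length_rotate by blast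
  ultimately have "?cs \<in> loops A k" using sub by (simp add: loops_def)
  then show ?thesis using w by blast
qed

definition cycle_nums :: "sym list set \<Rightarrow> nat set" where
  "cycle_nums X = {a. Num a \<in> \<Union> (set ` X)}"

definition box_cycles :: "nat set \<Rightarrow> sym list set set" where
  "box_cycles A = {X. \<exists>c. X = cyc c \<and> (odd_box_cycle A c \<or> rev_odd_box_cycle A c)}"

definition cycles_at :: "nat set \<Rightarrow> nat \<Rightarrow> sym list set set" where
  "cycles_at A k = {X \<in> box_cycles A. k \<in> cycle_nums X}"

lemma cycle_nums_cyc: "cycle_nums (cyc c) = {a. Num a \<in> set c}"
  unfolding cycle_nums_def Union_set_cyc ..

lemma cycle_nums_word [simp]:
  "cycle_nums (cyc (word cs)) = set (nums cs)" "cycle_nums (cyc (rev (word cs))) = set (nums cs)"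
  by (simp_all add: cycle_nums_cyc)

lemma rev_odd_box_cycle_rev: "rev_odd_box_cycle A (rev c) \<longleftrightarrow> odd_box_cycle A c"
  unfolding odd_box_cycle_def rev_odd_box_cycle_def
  using box_cycle_gen_rev[of "(<)" A c] box_cycle_gen_rev[of "(>)" A "rev c"] by auto

text \<open>A reverse odd cycle is the reversal of an odd one, so the normal form applies to
  \<open>rev c\<close>. The two images share only the cycle of \<open>[Free k]\<close>, by
  \<open>cyc_word_neq_cyc_rev\<close>.\<close>

lemma cycles_at_eq:
  assumes "\<forall>a\<in>A. a \<le> k"
  shows "cycles_at A k = (\<lambda>cs. cyc (word cs)) ` loops A k \<union> (\<lambda>cs. cyc (rev (word cs))) ` loops A k"
proof (intro equalityI subsetI)
  fix X assume "X \<in> cycles_at A k"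
  then obtain c where c: "X = cyc c" "odd_box_cycle A c \<or> rev_odd_box_cycle A c"
    "k \<in> cycle_nums X"
    unfolding cycles_at_def box_cycles_def by blast
  have X: "X = cyc c" "odd_box_cycle A c \<or> odd_box_cycle A (rev c)" "Num k \<in> set c"
    using c rev_odd_box_cycle_rev[of A "rev c"] by (simp_all add: cycle_nums_cyc)
  show "X \<in> (\<lambda>cs. cyc (word cs)) ` loops A k \<union> (\<lambda>cs. cyc (rev (word cs))) ` loops A k"
    using X(2)
  proof
    assume "odd_box_cycle A c"
    then obtain cs n where "cs \<in> loops A k" "word cs = rotate n c"
      using box_cycle_gen_normal_form X(3) assms unfolding odd_box_cycle_def by blast
    then show ?thesis using X(1) by (metis UnI1 cyc_rotate image_eqI)
  next
    assume "odd_box_cycle A (rev c)"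
    then obtain cs n where "cs \<in> loops A k" "word cs = rotate n (rev c)"
      using box_cycle_gen_normal_form[of A "rev c" k] X(3) assms unfolding odd_box_cycle_def by auto
    moreover from this have "cyc (rev (word cs)) = cyc c"
      by (metis cyc_rev cyc_rotate rev_rev_ident)
    ultimately show ?thesis using X(1) by blast
  qed
next
  fix X assume "X \<in> (\<lambda>cs. cyc (word cs)) ` loops A k \<union> (\<lambda>cs. cyc (rev (word cs))) ` loops A k"
  then obtain cs where cs: "cs \<in> loops A k" "X = cyc (word cs) \<or> X = cyc (rev (word cs))" by blast
  then have "odd_box_cycle A (word cs)"
    using box_cycle_gen_word assms unfolding odd_box_cycle_def by blast
  moreover have "k \<in> set (nums cs)"
    using cs(1) by (cases cs) (auto simp: loops_def)
  ultimately show "X \<in> cycles_at A k"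
    using cs(2) rev_odd_box_cycle_rev unfolding cycles_at_def box_cycles_def by auto
qed

subsection \<open>Detaching a cycle from a box-permutation\<close>

text \<open>A nontrivial rotation would begin with an entry of \<open>v\<close>. With
  \<open>x = Num k\<close>, a cycle therefore determines its representative starting at the
  maximum.\<close>

lemma rotate_hd_unique:
  assumes "rotate n (x # v) = x # u" "x \<notin> set v"
  shows "u = v"
proof -
  define m where "m = n mod length (x # v)"
  have eq: "drop m (x # v) @ take m (x # v) = x # u"
    using assms(1) by (simp only: rotate_drop_take m_def)
  show ?thesis
  proof (cases m)
    case 0
    then show ?thesis using eq by simp
  next
    case (Suc j)
    have "m < length (x # v)" unfolding m_def by (rule mod_less_divisor) simp
    then have "j < length v" using Suc by simp
    then obtain y d where d: "drop j v = y # d" by (metis Cons_nth_drop_Suc)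
    have "y \<in> set (drop j v)" unfolding d by simp
    then have "y \<in> set v" by (rule in_set_dropD)
    moreover have "y = x" using eq Suc d by simp
    ultimately show ?thesis using assms(2) by simp
  qed
qed

lemma word_loops:
  assumes "cs \<in> loops A k"
  obtains w where "word cs = Num k # w" "Num k \<notin> set w"
proof -
  have L: "cs \<noteq> []" "fst_num (hd cs) = k" "distinct (nums cs)" using assms by (auto simp: loops_def)
  then obtain w where w: "word cs = Num k # w" using hd_word[of cs] by (cases "word cs") auto
  have "k \<in> set (nums cs)" using w Num_in_word[of k cs] by simp
  then have "count_list (word cs) (Num k) = 1"
    using L(3) by (simp add: count_word count_list_distinct)
  then have "Num k \<notin> set w" using w by (simp add: count_list_0_iff)
  then show ?thesis using that w by blast
qed

lemma cyc_word_inj: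
  assumes "cs \<in> loops A k" "ds \<in> loops A k" "cyc (word cs) = cyc (word ds)"
  shows "cs = ds"
proof -
  obtain n where n: "word cs = rotate n (word ds)"
    using self_in_cyc[of "word cs"] assms(3) by (auto simp: cyc_def)
  obtain u where u: "word cs = Num k # u" using assms(1) by (rule word_loops)
  obtain v where v: "word ds = Num k # v" "Num k \<notin> set v" using assms(2) by (rule word_loops)
  have "u = v" using rotate_hd_unique[of n "Num k" v u] n u v by simp
  then show ?thesis using u v word_inj by simp
qed

lemma cyc_rev_word_inj:
  assumes "cs \<in> loops A k" "ds \<in> loops A k" "cyc (rev (word cs)) = cyc (rev (word ds))"
  shows "cs = ds"
  using cyc_word_inj[OF assms(1,2)] assms(3) by (metis cyc_rev rev_rev_ident)

text \<open>The rotation of a reversed word that starts at its maximum ends in a box,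
  whereas no word does.\<close>

lemma cyc_word_neq_cyc_rev:
  assumes "cs \<in> loops A k" "Boxed k b # vs \<in> loops A k"
  shows "cyc (word cs) \<noteq> cyc (rev (word (Boxed k b # vs)))"
proof
  let ?r = "rev (word (Boxed k b # vs))"
  assume eq: "cyc (word cs) = cyc ?r"
  let ?u = "rev (word vs) @ [Num b, Box]"
  have "rotate (length ?u) ?r = Num k # ?u"
    using rotate_append[of ?u "[Num k]"] by simp
  then have "cyc ?r = cyc (Num k # ?u)" by (metis cyc_rotate)
  then have "Num k # ?u \<in> cyc (word cs)" unfolding eq by (metis self_in_cyc)
  then obtain n where n: "Num k # ?u = rotate n (word cs)" unfolding cyc_def by blast
  obtain v where v: "word cs = Num k # v" "Num k \<notin> set v" using assms(1) by (rule word_loops)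
  have "v = ?u" using rotate_hd_unique[of n "Num k" v ?u] n v by simp
  then have "last (word cs) = Box" using v by simp
  then show False using last_word[of cs] v by (cases "cs = []") auto
qed

lemma Union_cyc_box_nbrs:
  "length c \<ge> 3 \<Longrightarrow> (\<Union>d\<in>cyc c. cyc_box_nbrs d) = cyc_box_nbrs c"
  by (auto simp: cyc_def cyc_box_nbrs_rotate)

lemma cycle_nbrs_loops:
  assumes "cs \<in> loops A k" "\<forall>a\<in>A. a \<le> k"
  shows "(\<Union>c\<in>cyc (word cs). cyc_box_nbrs c) = nbrs cs"
    "(\<Union>c\<in>cyc (rev (word cs)). cyc_box_nbrs c) = nbrs cs"
proof -
  have "(\<Union>c\<in>cyc (word cs). cyc_box_nbrs c) = nbrs cs
    \<and> (\<Union>c\<in>cyc (rev (word cs)). cyc_box_nbrs c) = nbrs cs"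
    using assms
  proof (cases rule: loops_cases)
    case 1
    then show ?thesis by (simp add: cyc_def cyc_box_nbrs_def nbrs_def)
  next
    case (2 b vs)
    then have "length (word cs) \<ge> 3" by simp
    then show ?thesis
      using Union_cyc_box_nbrs[of "word cs"] Union_cyc_box_nbrs[of "rev (word cs)"]
        cyc_box_nbrs_rev[of "word cs"] cyc_box_nbrs_word[of cs] 2 by auto
  qed
  then show "(\<Union>c\<in>cyc (word cs). cyc_box_nbrs c) = nbrs cs"
    "(\<Union>c\<in>cyc (rev (word cs)). cyc_box_nbrs c) = nbrs cs" by blast+
qed

text \<open>An odd \<open>cs\<close> is nonempty, so the clause of \<open>splits\<close> for empty
  \<open>cs\<close> is vacuous and the conditions on \<open>us\<close> and \<open>cs\<close>
  separate.\<close>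

lemma splits_odd_iff:
  "(us, cs) \<in> splits A k \<and> odd (length cs) \<longleftrightarrow> cs \<in> loops A k \<and> us \<in> paths (A - set (nums cs))"
  unfolding splits_def loops_def paths_def by auto

fun detach :: "token list \<times> token list \<Rightarrow> sym list set \<times> token list" where
  "detach (us, cs) =
     (if odd (length cs) then (cyc (word cs), us)
      else (let (us', cs') = move (us, cs) in (cyc (rev (word cs')), us')))"

text \<open>In the even case \<open>p\<close> is recovered by a second \<open>move\<close>. The new
  \<open>cs\<close> is not \<open>[Free k]\<close>, so it starts with a block; hence the reversed
  branch never produces the singleton cycle.\<close>

lemma detach_cases:
  assumes "p \<in> splits A k" "\<forall>a\<in>A. a \<le> k"
  obtains us cs where "cs \<in> loops A k" "us \<in> paths (A - set (nums cs))" "p = (us, cs)"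
      "detach p = (cyc (word cs), us)" "nbrs (fst p) \<union> nbrs (snd p) = nbrs us \<union> nbrs cs"
  | us b vs where "Boxed k b # vs \<in> loops A k" "us \<in> paths (A - set (nums (Boxed k b # vs)))"
      "p = move (us, Boxed k b # vs)" "detach p = (cyc (rev (word (Boxed k b # vs))), us)"
      "nbrs (fst p) \<union> nbrs (snd p) = nbrs us \<union> nbrs (Boxed k b # vs)"
proof -
  obtain us cs where p: "p = (us, cs)" by (cases p)
  show ?thesis
  proof (cases "odd (length cs)")
    case True
    then show ?thesis using that(1)[of cs us] assms(1) splits_odd_iff[of us cs A k] p by simp
  next
    case False
    obtain us' cs' where mv: "move (us, cs) = (us', cs')" by (cases "move (us, cs)")
    have "cs \<noteq> [Free k]" using False by auto
    note M = move_splits[OF assms(1)[unfolded p] this assms(2) mv]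
    then have L: "cs' \<in> loops A k" "us' \<in> paths (A - set (nums cs'))"
      using splits_odd_iff[of us' cs' A k] False by auto
    from L(1) assms(2) obtain b vs where "cs' = Boxed k b # vs"
      using M(4) by (cases rule: loops_cases) auto
    then show ?thesis using that(2)[of b vs us'] L M mv False by (simp add: p del: move.simps)
  qed
qed

lemma move_loops:
  assumes "Boxed k b # vs \<in> loops A k" "us \<in> paths (A - set (nums (Boxed k b # vs)))"
    "\<forall>a\<in>A. a \<le> k"
  shows "move (us, Boxed k b # vs) \<in> splits A k"
    "detach (move (us, Boxed k b # vs)) = (cyc (rev (word (Boxed k b # vs))), us)"
proof -
  let ?cs = "Boxed k b # vs"
  have S: "(us, ?cs) \<in> splits A k" "odd (length ?cs)"
    using splits_odd_iff assms(1,2) by blast+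
  obtain us' cs' where mv: "move (us, ?cs) = (us', cs')" by (cases "move (us, ?cs)")
  have "?cs \<noteq> [Free k]" by simp
  note M = move_splits[OF S(1) this assms(3) mv]
  then show "move (us, ?cs) \<in> splits A k"
    "detach (move (us, ?cs)) = (cyc (rev (word ?cs)), us)"
    using mv S(2) by (simp_all del: move.simps)
qed

text \<open>Each branch is injective because a cycle determines its loop, and the branches have
  disjoint images because a loop starting with a block is never the reversal of a loop. Reversed
  loops starting with a block are reached through \<open>move\<close>.\<close>

lemma bij_detach:
  assumes max: "\<forall>a\<in>A. a \<le> k"
  shows "bij_betw detach (splits A k) (SIGMA X:cycles_at A k. paths (A - cycle_nums X))"
  unfolding bij_betw_def
proof
  show "inj_on detach (splits A k)"
  proof (rule inj_onI)
    fix p q assume p: "p \<in> splits A k" and q: "q \<in> splits A k" and eq: "detach p = detach q"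
    from p max show "p = q"
    proof (cases rule: detach_cases)
      case p: (1 us cs)
      from q max show ?thesis
      proof (cases rule: detach_cases)
        case (1 vs ds)
        then show ?thesis using p eq cyc_word_inj[of cs A k ds] by simp
      next
        case (2 vs b ws)
        then show ?thesis using p eq cyc_word_neq_cyc_rev[of cs A k b ws] by simp
      qed
    next
      case p: (2 us b vs)
      from q max show ?thesis
      proof (cases rule: detach_cases)
        case (1 ws ds)
        then show ?thesis using p eq cyc_word_neq_cyc_rev[of ds A k b vs] by simp
      next
        case (2 ws c ds)
        then show ?thesis using p eq cyc_rev_word_inj[of "Boxed k b # vs" A k "Boxed k c # ds"]
          by (metis Pair_inject)
      qed
    qed
  qed
next
  show "detach ` splits A k = (SIGMA X:cycles_at A k. paths (A - cycle_nums X))"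
  proof (intro equalityI subsetI)
    fix y assume "y \<in> detach ` splits A k"
    then obtain p where p: "p \<in> splits A k" "y = detach p" by blast
    from p(1) max show "y \<in> (SIGMA X:cycles_at A k. paths (A - cycle_nums X))"
    proof (cases rule: detach_cases)
      case (1 us cs)
      then show ?thesis using p(2) by (auto simp: cycles_at_eq[OF max])
    next
      case (2 us b vs)
      then show ?thesis using p(2)
        by (auto simp: cycles_at_eq[OF max] simp del: word_simps nums_simps)
    qed
  next
    fix y assume "y \<in> (SIGMA X:cycles_at A k. paths (A - cycle_nums X))"
    then obtain X us where y: "y = (X, us)" "X \<in> cycles_at A k" "us \<in> paths (A - cycle_nums X)"
      by blast
    from y(2) consider cs where "cs \<in> loops A k" "X = cyc (word cs)"
      | cs where "cs \<in> loops A k" "X = cyc (rev (word cs))"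
      unfolding cycles_at_eq[OF max] by blast
    then have "\<exists>p\<in>splits A k. detach p = y"
    proof cases
      case (1 cs)
      then have S: "(us, cs) \<in> splits A k" "odd (length cs)" using splits_odd_iff y(3) by auto
      then have "detach (us, cs) = y" using 1 y(1) by simp
      then show ?thesis using S(1) by blast
    next
      case cs: (2 cs)
      have us: "us \<in> paths (A - set (nums cs))" using y(3) unfolding cs(2) cycle_nums_word .
      from cs(1) max show ?thesis
      proof (cases rule: loops_cases)
        \<comment> \<open>The word of \<open>[Free k]\<close> is its own reversal, so this cycle
          comes from the odd branch.\<close>
        case 1
        have S: "(us, cs) \<in> splits A k" "odd (length cs)" using splits_odd_iff cs(1) us by blast+
        then have "detach (us, cs) = y" using 1 cs(2) y(1) by simp
        then show ?thesis using S(1) by blast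
      next
        case (2 b vs)
        show ?thesis
          using move_loops[OF cs(1)[unfolded 2] us[unfolded 2] max] unfolding y(1) cs(2) 2 by blast
      qed
    qed
    then show "y \<in> detach ` splits A k" by blast
  qed
qed

lemma bij_split:
  assumes "k \<in> A" "\<forall>a\<in>A. a \<le> k"
  shows "bij_betw (\<lambda>ts. (takeWhile (\<lambda>t. fst_num t \<noteq> k) ts, dropWhile (\<lambda>t. fst_num t \<noteq> k) ts))
    (paths A) (splits A k)"
  by (rule bij_betw_byWitness[where f' = "\<lambda>(us, cs). us @ cs"])
    (use split_path[OF _ assms] splits_append[OF _ assms(2)] in \<open>auto split: prod.splits\<close>)

lemma detach_path:
  assumes "k \<in> A" "\<forall>a\<in>A. a \<le> k"
  obtains \<phi> where "bij_betw \<phi> (paths A) (SIGMA X:cycles_at A k. paths (A - cycle_nums X))"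
    "\<And>ts. ts \<in> paths A \<Longrightarrow> nbrs ts = (\<Union>c\<in>fst (\<phi> ts). cyc_box_nbrs c) \<union> nbrs (snd (\<phi> ts))"
proof
  let ?f = "\<lambda>ts. (takeWhile (\<lambda>t. fst_num t \<noteq> k) ts, dropWhile (\<lambda>t. fst_num t \<noteq> k) ts)"
  show "bij_betw (detach \<circ> ?f) (paths A) (SIGMA X:cycles_at A k. paths (A - cycle_nums X))"
    using bij_split[OF assms] bij_detach[OF assms(2)] by (rule bij_betw_trans)
  fix ts assume ts: "ts \<in> paths A"
  have "nbrs ts = nbrs (fst (?f ts)) \<union> nbrs (snd (?f ts))"
    by (simp flip: nbrs_append)
  moreover have "nbrs (fst (?f ts)) \<union> nbrs (snd (?f ts)) =
    (\<Union>c\<in>fst (detach (?f ts)). cyc_box_nbrs c) \<union> nbrs (snd (detach (?f ts)))"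
    using split_path[OF ts assms] assms(2)
  proof (cases rule: detach_cases)
    case (1 us cs)
    then show ?thesis using cycle_nbrs_loops(1)[OF 1(1) assms(2)] by (simp add: Un_commute)
  next
    case (2 us b vs)
    then show ?thesis using cycle_nbrs_loops(2)[OF 2(1) assms(2)]
      by (metis Un_commute fst_conv snd_conv)
  qed
  ultimately show "nbrs ts = (\<Union>c\<in>fst ((detach \<circ> ?f) ts). cyc_box_nbrs c)
      \<union> nbrs (snd ((detach \<circ> ?f) ts))" by simp
qed

subsection \<open>Cyclic box-permutations as cycle sets\<close>

lemma cBP_iff:
  "S \<in> cBP A \<longleftrightarrow> S \<subseteq> box_cycles A \<and> (\<forall>a\<in>A. \<exists>!X. X \<in> S \<and> a \<in> cycle_nums X)"
  by (simp add: cBP_def box_cycles_def cycle_nums_def subset_iff Ball_def)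

lemma box_cyclesE:
  assumes "X \<in> box_cycles A"
  obtains c R where "X = cyc c" "box_cycle_gen R A c" "R = (<) \<or> R = (>)"
  using assms that[of _ "(<)"] that[of _ "(>)"]
  by (auto simp: box_cycles_def odd_box_cycle_def rev_odd_box_cycle_def)

lemma box_cyclesI: "box_cycle_gen R A c \<Longrightarrow> R = (<) \<or> R = (>) \<Longrightarrow> cyc c \<in> box_cycles A"
  by (auto simp: box_cycles_def odd_box_cycle_def rev_odd_box_cycle_def)

lemma box_cycles_nums_subset:
  assumes "X \<in> box_cycles A"
  shows "cycle_nums X \<subseteq> A"
  using assms
proof (rule box_cyclesE)
  fix c and R :: "nat \<Rightarrow> nat \<Rightarrow> bool"
  assume "X = cyc c" "box_cycle_gen R A c"
  then show ?thesis using box_cycle_gen_set[of R A c] by (auto simp: cycle_nums_cyc)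
qed

lemma box_cycles_mono:
  assumes "B \<subseteq> A"
  shows "box_cycles B \<subseteq> box_cycles A"
proof
  fix X assume "X \<in> box_cycles B"
  then obtain c R where c: "X = cyc c" "box_cycle_gen R B c" "R = (<) \<or> R = (>)"
    by (rule box_cyclesE)
  show "X \<in> box_cycles A"
    unfolding c(1) using box_cycle_gen_mono[OF c(2) assms] c(3) by (rule box_cyclesI)
qed

text \<open>With \<open>box_cycles_mono\<close>, this passes cycles between \<open>A\<close> and the
  numbers left after one cycle is removed.\<close>

lemma box_cycles_restrict:
  assumes "X \<in> box_cycles A" "B \<subseteq> A" "cycle_nums X \<subseteq> B"
  shows "X \<in> box_cycles B"
  using assms(1)
proof (rule box_cyclesE)
  fix c R assume c: "X = cyc c" "box_cycle_gen R A c" "R = (<) \<or> R = (>)"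
  have "{a. Num a \<in> set c} \<subseteq> B" using assms(3) c(1) by (simp add: cycle_nums_cyc)
  then have "x \<in> insert Box (Num ` B)" if "x \<in> set c" for x
    using that by (induction x) blast+
  then have "set c \<subseteq> insert Box (Num ` B)" by (rule subsetI)
  then have "box_cycle_gen R B c" by (rule box_cycle_gen_restrict[OF c(2) assms(2)])
  then show ?thesis unfolding c(1) using c(3) by (rule box_cyclesI)
qed

text \<open>A cycle without numbers would consist of boxes only, and cutting it at a box leaves an
  empty first run.\<close>

lemma box_cycles_empty: "box_cycles {} = {}"
proof -
  have empty: False if "box_cycle_gen R {} c" for R c
  proof -
    have C: "set c \<subseteq> {Box}" "Box \<in> set c" "runs_ok R c"
      using that by (auto simp: box_cycle_gen_iff)
    then obtain v where v: "c = Box # v" by (cases c) auto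
    then have "rotate 0 c = Box # v" by simp
    then have "\<forall>s\<in>set (segs v). 2 \<le> length s" using C(3) unfolding runs_ok_def by blast
    then have "2 \<le> length (hd (segs v))" by simp
    moreover have "hd (segs v) = []" using C(1) v by (cases v rule: segs.cases) auto
    ultimately show False by simp
  qed
  have "X \<notin> box_cycles {}" for X
  proof
    assume "X \<in> box_cycles {}"
    then show False by (rule box_cyclesE) (rule empty)
  qed
  then show ?thesis by blast
qed

text \<open>The inverse removes the unique cycle through \<open>k\<close>; the other cycles are
  disjoint from it and so live on the remaining numbers.\<close>

lemma bij_insert_cycle:
  assumes "k \<in> A"
  shows "bij_betw (\<lambda>(X, S). insert X S) (SIGMA X:cycles_at A k. cBP (A - cycle_nums X)) (cBP A)"
  unfolding bij_betw_def
proof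
  have at: "X \<in> box_cycles A" "k \<in> cycle_nums X" if "X \<in> cycles_at A k" for X
    using that by (auto simp: cycles_at_def)
  have rest: "cycle_nums Y \<subseteq> A - cycle_nums X" if "S \<in> cBP (A - cycle_nums X)" "Y \<in> S" for X Y S
  proof (rule box_cycles_nums_subset)
    show "Y \<in> box_cycles (A - cycle_nums X)" using that unfolding cBP_iff by blast
  qed
  show "inj_on (\<lambda>(X, S). insert X S) (SIGMA X:cycles_at A k. cBP (A - cycle_nums X))"
  proof (rule inj_onI)
    fix p q assume "p \<in> (SIGMA X:cycles_at A k. cBP (A - cycle_nums X))"
      "q \<in> (SIGMA X:cycles_at A k. cBP (A - cycle_nums X))"
      and pq: "(\<lambda>(X, S). insert X S) p = (\<lambda>(X, S). insert X S) q"
    then obtain X S Y T where X: "p = (X, S)" "X \<in> cycles_at A k" "S \<in> cBP (A - cycle_nums X)"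
      and Y: "q = (Y, T)" "Y \<in> cycles_at A k" "T \<in> cBP (A - cycle_nums Y)" by (elim SigmaE)
    have eq: "insert X S = insert Y T" using pq X(1) Y(1) by simp
    \<comment> \<open>Members of \<open>S\<close> and \<open>T\<close> avoid \<open>k\<close>, so
      the inserted cycle can be recognized in the union.\<close>
    have notin: "Z \<notin> S" "Z \<notin> T" if "k \<in> cycle_nums Z" for Z
      using that rest[OF X(3), of Z] rest[OF Y(3), of Z] at(2)[OF X(2)] at(2)[OF Y(2)] by auto
    have "X \<in> insert Y T" by (simp flip: eq)
    then have XY: "X = Y" using notin(2)[OF at(2)[OF X(2)]] by simp
    moreover have "X \<notin> S" "X \<notin> T" using notin at(2)[OF X(2)] by simp_all
    then have "S = T" using eq unfolding XY by (simp add: insert_ident)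
    ultimately show "p = q" using X(1) Y(1) by simp
  qed
  show "(\<lambda>(X, S). insert X S) ` (SIGMA X:cycles_at A k. cBP (A - cycle_nums X)) = cBP A"
  proof (intro equalityI subsetI)
    fix S' assume "S' \<in> (\<lambda>(X, S). insert X S) ` (SIGMA X:cycles_at A k. cBP (A - cycle_nums X))"
    then obtain X S where X: "X \<in> cycles_at A k" and S: "S \<in> cBP (A - cycle_nums X)"
      and S': "S' = insert X S" by auto
    have "S \<subseteq> box_cycles A" using S box_cycles_mono[of "A - cycle_nums X" A] unfolding cBP_iff by blast
    moreover have "\<exists>!Y. Y \<in> insert X S \<and> a \<in> cycle_nums Y" if a: "a \<in> A" for a
    proof (cases "a \<in> cycle_nums X")
      case True
      moreover have "a \<notin> cycle_nums Y" if "Y \<in> S" for Y using rest[OF S that] True by blast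
      ultimately show ?thesis by (intro ex1I[of _ X]) blast+
    next
      case False
      then have "\<exists>!Y. Y \<in> S \<and> a \<in> cycle_nums Y" using S a unfolding cBP_iff by simp
      then obtain Y where "Y \<in> S" "a \<in> cycle_nums Y" "\<forall>Z\<in>S. a \<in> cycle_nums Z \<longrightarrow> Z = Y"
        by blast
      then show ?thesis using False by (intro ex1I[of _ Y]) blast+
    qed
    ultimately show "S' \<in> cBP A" using at(1)[OF X] unfolding cBP_iff S' by simp
  next
    fix S assume S: "S \<in> cBP A"
    then obtain X where X: "X \<in> S" "k \<in> cycle_nums X" using assms unfolding cBP_iff by blast
    have disj: "cycle_nums Y \<inter> cycle_nums X = {}" if "Y \<in> S" "Y \<noteq> X" for Y
    proof (rule ccontr)
      assume "cycle_nums Y \<inter> cycle_nums X \<noteq> {}"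
      then obtain a where a: "a \<in> cycle_nums Y" "a \<in> cycle_nums X" by blast
      have "Y \<in> box_cycles A" using S that(1) unfolding cBP_iff by blast
      then have "a \<in> A" using box_cycles_nums_subset a(1) by blast
      then have "\<exists>!X. X \<in> S \<and> a \<in> cycle_nums X" using S unfolding cBP_iff by blast
      then show False using a that X(1) by blast
    qed
    have "Y \<in> box_cycles (A - cycle_nums X)" if "Y \<in> S" "Y \<noteq> X" for Y
    proof (rule box_cycles_restrict)
      show Y: "Y \<in> box_cycles A" using S that(1) unfolding cBP_iff by blast
      show "cycle_nums Y \<subseteq> A - cycle_nums X"
        using box_cycles_nums_subset[OF Y] disj[OF that] by blast
    qed blast
    moreover have "\<exists>!Y. Y \<in> S - {X} \<and> a \<in> cycle_nums Y" if "a \<in> A - cycle_nums X" for a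
    proof -
      have "\<exists>!Y. Y \<in> S \<and> a \<in> cycle_nums Y" using S that unfolding cBP_iff by simp
      then obtain Y where "Y \<in> S" "a \<in> cycle_nums Y" "\<forall>Z\<in>S. a \<in> cycle_nums Z \<longrightarrow> Z = Y"
        by blast
      then show ?thesis using that by (intro ex1I[of _ Y]) blast+
    qed
    ultimately have "S - {X} \<in> cBP (A - cycle_nums X)" unfolding cBP_iff by auto
    moreover have "X \<in> cycles_at A k" using X S unfolding cycles_at_def cBP_iff by blast
    moreover have "S = insert X (S - {X})" using X(1) by blast
    ultimately show "S \<in> (\<lambda>(X, S). insert X S) ` (SIGMA X:cycles_at A k. cBP (A - cycle_nums X))"
      by (intro image_eqI[of _ _ "(X, S - {X})"]) auto
  qed
qed

section \<open>Recursion on the remaining numbers\<close>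

lemma bij_betw_Sigma:
  assumes "\<And>x. x \<in> I \<Longrightarrow> bij_betw (f x) (B x) (C x)"
  shows "bij_betw (\<lambda>(x, y). (x, f x y)) (Sigma I B) (Sigma I C)"
  unfolding bij_betw_def
proof (intro conjI equalityI subsetI)
  show "inj_on (\<lambda>(x, y). (x, f x y)) (Sigma I B)"
    using assms by (auto simp: inj_on_def bij_betw_def)
next
  fix z assume "z \<in> (\<lambda>(x, y). (x, f x y)) ` Sigma I B"
  then show "z \<in> Sigma I C" using assms by (auto dest: bij_betwE)
next
  fix z assume "z \<in> Sigma I C"
  then obtain x c where z: "z = (x, c)" "x \<in> I" "c \<in> C x" by blast
  then obtain y where "y \<in> B x" "c = f x y" using assms[of x] by (auto simp: bij_betw_def)
  then show "z \<in> (\<lambda>(x, y). (x, f x y)) ` Sigma I B"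
    using z by (intro image_eqI[of _ _ "(x, y)"]) auto
qed

text \<open>Detach the cycle through the maximum, apply the bijection for the remaining numbers, and
  insert the cycle again. Since the cycle may use up many numbers, the induction is over all proper
  subsets.\<close>

lemma paths_bij_cBP:
  assumes "finite A"
  shows "\<exists>\<psi>. bij_betw \<psi> (paths A) (cBP A) \<and> (\<forall>ts\<in>paths A. cbox_nbrs (\<psi> ts) = nbrs ts)"
  using assms
proof (induction rule: finite_psubset_induct)
  case (psubset A)
  show ?case
  proof (cases "A = {}")
    case True
    \<comment> \<open>Every token carries a number.\<close>
    have "ts = []" if "set (nums ts) = {}" for ts
      using that by (cases ts) (auto dest: equalityD1 simp: token_nums_eq)
    then have "paths {} = {[]}" by (auto simp: paths_def)
    moreover have "cBP {} = {{}}" by (auto simp: cBP_iff box_cycles_empty)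
    ultimately show ?thesis unfolding True
      by (intro exI[of _ "\<lambda>_. {}"]) (auto simp: bij_betw_def cbox_nbrs_def)
  next
    case False
    define k where "k = Max A"
    have k: "k \<in> A" "\<forall>a\<in>A. a \<le> k" using psubset.hyps False by (auto simp: k_def)
    obtain \<phi> where \<phi>: "bij_betw \<phi> (paths A) (SIGMA X:cycles_at A k. paths (A - cycle_nums X))"
      "\<And>ts. ts \<in> paths A \<Longrightarrow> nbrs ts = (\<Union>c\<in>fst (\<phi> ts). cyc_box_nbrs c) \<union> nbrs (snd (\<phi> ts))"
      using detach_path[OF k] by blast
    \<comment> \<open>The detached cycle contains \<open>k\<close>, so the remaining set is a proper
      subset. One bijection is then chosen for each cycle.\<close>
    have "\<forall>X\<in>cycles_at A k. \<exists>\<psi>. bij_betw \<psi> (paths (A - cycle_nums X)) (cBP (A - cycle_nums X))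
      \<and> (\<forall>ts\<in>paths (A - cycle_nums X). cbox_nbrs (\<psi> ts) = nbrs ts)"
      using psubset.IH k(1) unfolding cycles_at_def by blast
    then obtain \<Psi> where \<Psi>:
      "\<And>X. X \<in> cycles_at A k \<Longrightarrow> bij_betw (\<Psi> X) (paths (A - cycle_nums X)) (cBP (A - cycle_nums X))"
      "\<And>X ts. X \<in> cycles_at A k \<Longrightarrow> ts \<in> paths (A - cycle_nums X) \<Longrightarrow> cbox_nbrs (\<Psi> X ts) = nbrs ts"
      by metis
    let ?g = "\<lambda>(X, us). (X, \<Psi> X us)" and ?h = "\<lambda>(X, S). insert X S"
    have "bij_betw (?h \<circ> (?g \<circ> \<phi>)) (paths A) (cBP A)"
      by (intro bij_betw_trans[OF bij_betw_trans[OF \<phi>(1) bij_betw_Sigma] bij_insert_cycle] \<Psi>(1) k(1))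
    moreover have "cbox_nbrs ((?h \<circ> (?g \<circ> \<phi>)) ts) = nbrs ts" if ts: "ts \<in> paths A" for ts
    proof -
      obtain X us where p: "\<phi> ts = (X, us)" by (cases "\<phi> ts")
      have "\<phi> ts \<in> (SIGMA X:cycles_at A k. paths (A - cycle_nums X))"
        using \<phi>(1) ts by (rule bij_betwE[rule_format])
      then have "cbox_nbrs (\<Psi> X us) = nbrs us" using p \<Psi>(2) by simp
      then show ?thesis using \<phi>(2)[OF ts] by (simp add: p cbox_nbrs_def)
    qed
    ultimately show ?thesis by blast
  qed
qed

theorem theorem2p1:
  fixes A :: "nat set"
  assumes "finite A" and "\<forall>a\<in>A. a > 0"
  shows "\<exists>\<psi>. bij_betw \<psi> (BP A) (cBP A) \<and> (\<forall>w\<in>BP A. cbox_nbrs (\<psi> w) = box_nbrs w)"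
proof -
  have w: "bij_betw word (paths A) (BP A)"
    unfolding bij_betw_def BP_eq_word_paths[OF assms(1)] by (auto intro: inj_onI word_inj)
  obtain \<psi> where \<psi>: "bij_betw \<psi> (paths A) (cBP A)" "\<forall>ts\<in>paths A. cbox_nbrs (\<psi> ts) = nbrs ts"
    using paths_bij_cBP[OF assms(1)] by blast
  let ?\<chi> = "\<psi> \<circ> the_inv_into (paths A) word"
  have "bij_betw ?\<chi> (BP A) (cBP A)"
    using bij_betw_the_inv_into[OF w] \<psi>(1) by (rule bij_betw_trans)
  moreover have "cbox_nbrs (?\<chi> v) = box_nbrs v" if "v \<in> BP A" for v
  proof -
    obtain ts where ts: "ts \<in> paths A" "v = word ts" using w \<open>v \<in> BP A\<close> by (auto simp: bij_betw_def)
    then have "?\<chi> v = \<psi> ts" using w by (simp add: bij_betw_def the_inv_into_f_f)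
    then show ?thesis using \<psi>(2) ts by (simp add: box_nbrs_word)
  qed
  ultimately show ?thesis by blast
qed

end
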